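(* Let $u\in\mathbb{C}$ and let $v\in\mathbb{R}$ with $v\neq 0$. Then the power series $$\sum_{n\ge 0}\frac{z^n}{\Gamma\bigl(u+\frac{2ivn}{\pi}\bigr)}$$ has the circle $|z|=e^{-|v|}$ as a natural boundary.
   Context: $\Gamma$ is the Euler Gamma function; $1/\Gamma$ is understood as the entire function which vanishes at the poles $0,-1,-2,\dots$ of $\Gamma$. A power series has the circle $|z|=R$ as a natural boundary if its radius of convergence is $R$ and its sum $f$, analytic in the disc $\Omega=\{|z|<R\}$, cannot be continued analytically across any point of the circle: for every $z_0$ with $|z_0|=R$ there is no open disc $D$ centred at $z_0$ and no holomorphic function $g$ on $D$ with $g=f$ on $D\cap\Omega$. *)

theory Defs
  imports "HOL-Complex_Analysis.Complex_Analysis"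
begin

text \<open>The circle is assumed to have positive finite radius, so that it is a genuine circle.
  Inside the disc of convergence \<open>\<Sum>n. a n * z ^ n\<close> is the sum of the power series;
  outside it the value of \<open>suminf\<close> is irrelevant because only points of the disc are compared.\<close>

definition has_natural_boundary :: "(nat \<Rightarrow> complex) \<Rightarrow> real \<Rightarrow> bool" where
  "has_natural_boundary a R \<longleftrightarrow>
     0 < R \<and> conv_radius a = ereal R \<and>
     (\<forall>z0. norm z0 = R \<longrightarrow>
        \<not> (\<exists>r>0. \<exists>g. g holomorphic_on ball z0 r \<and>
              (\<forall>z \<in> ball z0 r \<inter> ball 0 R. g z = (\<Sum>n. a n * z ^ n))))"

end

theory Submission
  imports Defs
begin

text \<open>
  Write \<open>c = 2 v / \<pi>\<close>. For \<open>v > 0\<close> the reflection formula turns \<open>1 / \<Gamma>(u + i c n)\<close> into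
  \<open>sin (\<pi> (u + i c n)) / \<pi>\<close> times \<open>\<Gamma>(\<beta> - i c n)\<close> with \<open>\<beta> = 1 - u\<close>. One exponential of the sine rescales
  the variable by \<open>e\<^sup>2\<^sup>v\<close>, the other one by \<open>e\<^sup>-\<^sup>2\<^sup>v\<close>, and the second contribution is analytic in a
  larger disc. So everything depends on \<open>\<Sum>n. \<Gamma>(\<beta> - i c n) w\<^sup>n\<close> and the circle \<open>|w| = e\<^sup>v\<close>
  (\<open>Gamma_line_series\<close>), at least when \<open>Re \<beta> > 0\<close>. The remaining \<open>u\<close> are reached by
  \<open>1 / \<Gamma>(s - 1) = (s - 1) / \<Gamma>(s)\<close>: passing from \<open>u\<close> to \<open>u - 1\<close> applies a first order
  differential operator to the series, and such an operator preserves continuability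
  (\<open>has_natural_boundary_Euler_operator\<close>). Complex conjugation gives \<open>v < 0\<close>.

  By Euler's integral in the variable \<open>x = ln t\<close>, the numbers \<open>\<Gamma>(\<beta> - i c n)\<close> are values of the Fourier
  transform of \<open>exp (\<beta> x - e\<^sup>x)\<close>; hence, up to a constant, they are the Fourier coefficients of its
  periodization \<open>H(y) = \<Sum>k\<in>\<int>. exp (\<beta> (y + k P) - e\<^bsup>y + k P\<^esup>)\<close> with \<open>P = 2 \<pi> / c\<close>. The function \<open>H\<close> is
  holomorphic in the strip \<open>|Im y| < \<pi> / 2\<close>, so in the variable \<open>w = e\<^bsup>i c y\<^esup>\<close> it is holomorphic in the annulus
  \<open>e\<^sup>-\<^sup>v < |w| < e\<^sup>v\<close>. The power series is the nonnegative part of its Laurent expansion, and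
  the negative part is holomorphic across \<open>|w| = e\<^sup>v\<close> (\<open>Laurent_nonneg_part\<close>). A continuation of the power
  series therefore makes \<open>H\<close> bounded near a point \<open>y0\<close> with \<open>Im y0 = - \<pi> / 2\<close>.

  This is impossible (\<open>log_period_sum_unbounded\<close>). Put \<open>\<tau> = e\<^sup>y\<close> and \<open>\<lambda> = e\<^sup>P\<close>, so that
  \<open>H(y) = \<tau>\<^sup>\<beta> L(\<tau>)\<close> where \<open>L(\<tau>) = \<Sum>k\<in>\<int>. \<lambda>\<^bsup>k \<beta>\<^esup> exp (- \<lambda>\<^sup>k \<tau>)\<close>. As \<open>H\<close> has period \<open>P\<close>, a bound near \<open>y0\<close>
  holds near every \<open>y0 + m P\<close> too: in the variable \<open>\<tau>\<close> the small half disc becomes a half disc around \<open>- i \<lambda>\<^sup>m \<sigma>0\<close> whose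
  radius grows like \<open>\<lambda>\<^sup>m\<close>, and on it \<open>L\<close> is at most of the order of \<open>|\<tau>|\<close> to the power \<open>- Re \<beta>\<close>. Consequently \<open>L\<close> is
  arbitrarily small on arbitrarily long segments of the line \<open>Re \<tau> = 1\<close>. On that line \<open>L\<close> is an
  absolutely convergent sum of oscillations with frequencies \<open>\<lambda>\<^sup>k\<close>, and its mean against \<open>e\<^bsup>- i \<sigma>\<^esup>\<close> over a
  long segment recovers the coefficient \<open>e\<^sup>-\<^sup>1\<close> of \<open>k = 0\<close>, which is not zero
  (\<open>almost_periodic_coeff_zero\<close>).
\<close>

section \<open>Laurent splitting in an annulus\<close>

text \<open>
  Radial segments give a homotopy of concentric circles inside the annulus.
\<close>
lemma contour_integral_circlepath_indep:
  assumes g: "g holomorphic_on {z. r < norm z \<and> norm z < R}"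
      and "0 \<le> r" "r < a" "a < R" "r < b" "b < R"
  shows "contour_integral (circlepath 0 a) g = contour_integral (circlepath 0 b) g"
proof (rule Cauchy_theorem_homotopic_loops[OF _ _ g])
  show "homotopic_loops {z. r < norm z \<and> norm z < R} (circlepath 0 a) (circlepath 0 b)"
  proof (rule homotopic_loops_linear)
    fix t :: real
    let ?e = "exp (2 * of_real pi * \<i> * of_real t) :: complex"
    show "closed_segment (circlepath 0 a t) (circlepath 0 b t) \<subseteq> {z. r < norm z \<and> norm z < R}"
    proof
      fix x assume "x \<in> closed_segment (circlepath 0 a t) (circlepath 0 b t)"
      then obtain s where s: "0 \<le> s" "s \<le> 1"
        and x: "x = (1 - s) *\<^sub>R (of_real a * ?e) + s *\<^sub>R (of_real b * ?e)"
        by (auto simp: closed_segment_def circlepath)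
      have "x = of_real ((1 - s) * a + s * b) * ?e"
        by (simp add: x scaleR_conv_of_real algebra_simps)
      moreover have "norm ?e = 1" by simp
      ultimately have "norm x = \<bar>(1 - s) * a + s * b\<bar>" by (simp add: norm_mult del: of_real_add of_real_mult)
      moreover have "r < (1 - s) * a + s * b" "(1 - s) * a + s * b < R"
        using convex_bound_lt[of "-a" "-r" "-b" "1 - s" s] convex_bound_lt[of a R b "1 - s" s] s assms by auto
      ultimately show "x \<in> {z. r < norm z \<and> norm z < R}" using assms by auto
    qed
  qed auto
next
  show "open {z. r < norm z \<and> norm z < R}"
    by (intro open_Collect_conj open_Collect_less continuous_intros)
qed auto

lemma circlepath_Cauchy_kernel:
  assumes "b \<noteq> norm w" "0 < b"
  shows "((\<lambda>\<zeta>. 1 / (\<zeta> - w)) has_contour_integral (if norm w < b then 2 * of_real pi * \<i> else 0)) (circlepath 0 b)"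
proof (cases "norm w < b")
  case True
  then show ?thesis
    using Cauchy_integral_circlepath_simple[of "\<lambda>_. 1" 0 b w] by simp
next
  case False
  have "((\<lambda>\<zeta>. 1 / (\<zeta> - w)) has_contour_integral 0) (circlepath 0 b)"
  proof (rule Cauchy_theorem_convex_simple)
    show "(\<lambda>\<zeta>. 1 / (\<zeta> - w)) holomorphic_on ball 0 (norm w)"
      by (intro holomorphic_intros) auto
    show "path_image (circlepath 0 b) \<subseteq> ball 0 (cmod w)" using False assms by auto
  qed auto
  then show ?thesis using False by simp
qed

text \<open>
  Cauchy's formula for an annulus writes \<open>f w\<close> as the Cauchy integral over a circle outside \<open>w\<close> minus
  the one over the circle of radius \<open>\<rho>\<close> inside. Expanding the kernel of the former as a geometric series gives the
  power series, while the latter is holomorphic everywhere outside its circle. Since the outer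
  circle may be taken arbitrarily close to the circle of radius \<open>R\<close>, the power series converges in the whole disc, so that no estimate of the
  coefficients is needed.
\<close>
lemma Laurent_nonneg_part:
  assumes f: "f holomorphic_on {z. r < norm z \<and> norm z < R}"
      and r: "0 < r" "r < \<rho>" "\<rho> < R" 
  defines "c \<equiv> \<lambda>n. contour_integral (circlepath 0 \<rho>) (\<lambda>\<zeta>. f \<zeta> / \<zeta> ^ Suc n) / (2 * of_real pi * \<i>)"
  obtains h where "h holomorphic_on {z. \<rho> < norm z}"
    "\<And>w. norm w < R \<Longrightarrow> summable (\<lambda>n. c n * w ^ n)"
    "\<And>w. \<rho> < norm w \<Longrightarrow> norm w < R \<Longrightarrow> f w = (\<Sum>n. c n * w ^ n) + h w"
proof -
  let ?A = "{z. r < norm z \<and> norm z < R}" and ?p = "2 * of_real pi * \<i> :: complex"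
  have contf: "continuous_on ?A f" using f by (rule holomorphic_on_imp_continuous_on)
  have opA: "open ?A"
    by (intro open_Collect_conj open_Collect_less continuous_intros)
  have c_eq: "c n = contour_integral (circlepath 0 b) (\<lambda>\<zeta>. f \<zeta> / \<zeta> ^ Suc n) / ?p" if "r < b" "b < R" for n b
    unfolding c_def
  proof (subst contour_integral_circlepath_indep[of _ r R \<rho> b])
    show "(\<lambda>\<zeta>. f \<zeta> / \<zeta> ^ Suc n) holomorphic_on ?A"
      by (intro holomorphic_intros f) (use r in auto)
  qed (use that r in auto)
  have sums: "(\<lambda>n. c n * w ^ n) sums (contour_integral (circlepath 0 b) (\<lambda>\<zeta>. f \<zeta> / (\<zeta> - w)) / ?p)"
    if b: "r < b" "b < R" "norm w < b" for b w
  proof -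
    have b0: "b > 0" using b r by simp
    have sub: "sphere 0 b \<subseteq> ?A" using b b0 by auto
    have contb: "continuous_on (sphere 0 b) f" using contf sub by (rule continuous_on_subset)
    have int1: "(\<lambda>\<zeta>. f \<zeta> / \<zeta> ^ Suc n * w ^ n) contour_integrable_on circlepath 0 b" for n
      by (rule contour_integrable_continuous_circlepath) (use b0 in \<open>auto intro!: continuous_intros contb\<close>)
    obtain M where M: "\<And>x. x \<in> sphere 0 b \<Longrightarrow> norm (f x) \<le> M"
      using compact_imp_bounded[OF compact_continuous_image[OF contb compact_sphere]]
      unfolding bounded_iff by (metis imageI)
    have ul0: "uniform_limit (sphere 0 b) (\<lambda>N \<zeta>. \<Sum>n<N. f \<zeta> / \<zeta> ^ Suc n * w ^ n) (\<lambda>\<zeta>. \<Sum>n. f \<zeta> / \<zeta> ^ Suc n * w ^ n) sequentially"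
    proof (rule Weierstrass_m_test)
      show "norm (f \<zeta> / \<zeta> ^ Suc n * w ^ n) \<le> M / b * (norm w / b) ^ n" if "\<zeta> \<in> sphere 0 b" for \<zeta> n
      proof -
        have "norm (f \<zeta> / \<zeta> ^ Suc n * w ^ n) = norm (f \<zeta>) / b * (norm w / b) ^ n"
          using that by (simp add: norm_mult norm_divide norm_power power_divide)
        also have "\<dots> \<le> M / b * (norm w / b) ^ n"
          using M[OF that] b0 by (intro mult_right_mono divide_right_mono) auto
        finally show ?thesis .
      qed
      show "summable (\<lambda>n. M / b * (norm w / b) ^ n)"
        using b b0 by (intro summable_mult summable_geometric) (auto simp: norm_divide)
    qed
    have sum_eq: "(\<Sum>n. f \<zeta> / \<zeta> ^ Suc n * w ^ n) = f \<zeta> / (\<zeta> - w)" if "\<zeta> \<in> sphere 0 b" for \<zeta>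
    proof -
      have z: "\<zeta> \<noteq> 0" "norm (w / \<zeta>) < 1" using that b b0 by (auto simp: norm_divide)
      have "\<zeta> \<noteq> w" using that b by auto
      have "(\<lambda>n. f \<zeta> / \<zeta> * (w / \<zeta>) ^ n) sums (f \<zeta> / \<zeta> * (1 / (1 - w / \<zeta>)))"
        by (intro sums_mult geometric_sums z)
      also have "(\<lambda>n. f \<zeta> / \<zeta> * (w / \<zeta>) ^ n) = (\<lambda>n. f \<zeta> / \<zeta> ^ Suc n * w ^ n)"
        by (auto simp: field_simps)
      also have "f \<zeta> / \<zeta> * (1 / (1 - w / \<zeta>)) = f \<zeta> / (\<zeta> - w)"
        using z \<open>\<zeta> \<noteq> w\<close> by (simp add: divide_simps)
      finally show ?thesis by (rule sums_unique[symmetric])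
    qed
    have ul: "uniform_limit (sphere 0 b) (\<lambda>N \<zeta>. \<Sum>n<N. f \<zeta> / \<zeta> ^ Suc n * w ^ n) (\<lambda>\<zeta>. f \<zeta> / (\<zeta> - w)) sequentially"
      by (rule iffD1[OF uniform_limit_cong'[OF refl sum_eq] ul0])
    have "(\<lambda>N. contour_integral (circlepath 0 b) (\<lambda>\<zeta>. \<Sum>n<N. f \<zeta> / \<zeta> ^ Suc n * w ^ n))
            \<longlonglongrightarrow> contour_integral (circlepath 0 b) (\<lambda>\<zeta>. f \<zeta> / (\<zeta> - w))"
      by (rule contour_integral_uniform_limit_circlepath(2)[OF _ ul])
         (use b0 in \<open>auto simp del: power_Suc times_divide_eq_left intro!: always_eventually contour_integrable_sum int1\<close>)
    also have "(\<lambda>N. contour_integral (circlepath 0 b) (\<lambda>\<zeta>. \<Sum>n<N. f \<zeta> / \<zeta> ^ Suc n * w ^ n))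
       = (\<lambda>N. \<Sum>n<N. ?p * (c n * w ^ n))"
    proof
      fix N
      have "contour_integral (circlepath 0 b) (\<lambda>\<zeta>. \<Sum>n<N. f \<zeta> / \<zeta> ^ Suc n * w ^ n)
        = (\<Sum>n<N. contour_integral (circlepath 0 b) (\<lambda>\<zeta>. f \<zeta> / \<zeta> ^ Suc n * w ^ n))"
        by (rule contour_integral_sum) (use int1 in auto)
      also have "\<dots> = (\<Sum>n<N. ?p * (c n * w ^ n))"
      proof (rule sum.cong)
        fix n
        have "(\<lambda>\<zeta>. f \<zeta> / \<zeta> ^ Suc n) contour_integrable_on circlepath 0 b"
          by (rule contour_integrable_continuous_circlepath) (use b0 in \<open>auto intro!: continuous_intros contb\<close>)
        then have "contour_integral (circlepath 0 b) (\<lambda>\<zeta>. f \<zeta> / \<zeta> ^ Suc n * w ^ n) = ?p * c n * w ^ n"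
          by (subst contour_integral_rmul) (use c_eq[OF b(1,2), of n] in \<open>auto simp: field_simps\<close>)
        then show "contour_integral (circlepath 0 b) (\<lambda>\<zeta>. f \<zeta> / \<zeta> ^ Suc n * w ^ n) = ?p * (c n * w ^ n)"
          by simp
      qed auto
      finally show "contour_integral (circlepath 0 b) (\<lambda>\<zeta>. \<Sum>n<N. f \<zeta> / \<zeta> ^ Suc n * w ^ n) = (\<Sum>n<N. ?p * (c n * w ^ n))" .
    qed
    finally have "(\<lambda>n. ?p * (c n * w ^ n)) sums contour_integral (circlepath 0 b) (\<lambda>\<zeta>. f \<zeta> / (\<zeta> - w))"
      by (simp add: sums_def)
    then have "(\<lambda>n. ?p * (c n * w ^ n) / ?p) sums (contour_integral (circlepath 0 b) (\<lambda>\<zeta>. f \<zeta> / (\<zeta> - w)) / ?p)"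
      by (rule sums_divide)
    then show ?thesis by simp
  qed
  define h where "h w = - contour_integral (circlepath 0 \<rho>) (\<lambda>\<zeta>. f \<zeta> / (\<zeta> - w)) / ?p" for w
  have cont\<rho>: "continuous_on (sphere 0 \<rho>) f" using contf by (rule continuous_on_subset) (use r in auto)
  have intw: "(\<lambda>\<zeta>. f \<zeta> / (\<zeta> - w)) contour_integrable_on circlepath 0 b" 
    if "r < b" "b < R" "b \<noteq> norm w" for w b
  proof (rule contour_integrable_continuous_circlepath)
    show "continuous_on (path_image (circlepath 0 b)) (\<lambda>\<zeta>. f \<zeta> / (\<zeta> - w))"
      by (intro continuous_intros continuous_on_subset[OF contf]) (use that r in auto)
  qed
  have h_hol: "h holomorphic_on {z. \<rho> < norm z}"
  proof -
    have "(\<lambda>w. contour_integral (circlepath 0 \<rho>) (\<lambda>\<zeta>. f \<zeta> / (\<zeta> - w))) holomorphic_on {z. \<rho> < norm z}"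
    proof -
      have op: "open {z::complex. \<rho> < norm z}" by (intro open_Collect_less continuous_intros)
      have "((\<lambda>w. contour_integral (circlepath 0 \<rho>) (\<lambda>\<zeta>. f \<zeta> / (\<zeta> - w))) has_field_derivative 
              of_nat 1 * contour_integral (circlepath 0 \<rho>) (\<lambda>\<zeta>. f \<zeta> / (\<zeta> - w) ^ Suc 1)) (at w)" if "\<rho> < norm w" for w
      proof (rule Cauchy_next_derivative(2)[where B = "2 * pi * \<rho>" and S = "{z. \<rho> < norm z}"])
        show "continuous_on (path_image (circlepath 0 \<rho>)) f" using cont\<rho> r by simp
        show "((\<lambda>\<zeta>. f \<zeta> / (\<zeta> - w) ^ 1) has_contour_integral
            contour_integral (circlepath 0 \<rho>) (\<lambda>\<zeta>. f \<zeta> / (\<zeta> - w))) (circlepath 0 \<rho>)"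
          if "w \<in> {z. \<rho> < norm z} - path_image (circlepath 0 \<rho>)" for w
          using has_contour_integral_integral[OF intw[of \<rho> w]] that r by simp
        show "w \<in> {z. \<rho> < norm z} - path_image (circlepath 0 \<rho>)" using that r by auto
      qed (use r op in \<open>auto simp: vector_derivative_circlepath norm_mult\<close>)
      then show ?thesis
        unfolding holomorphic_on_def using field_differentiable_at_within field_differentiable_def by blast
    qed
    then show ?thesis unfolding h_def by (intro holomorphic_intros) auto
  qed
  show ?thesis
  proof (rule that[OF h_hol])
    fix w :: complex assume w: "norm w < R"
    define b where "b = (max \<rho> (norm w) + R) / 2"
    show "summable (\<lambda>n. c n * w ^ n)"
      using sums[of b w] w r by (auto simp: b_def sums_iff)
  next
    fix w :: complex assume w: "\<rho> < norm w" "norm w < R"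
    define b where "b = (norm w + R) / 2"
    have b: "norm w < b" "b < R" "r < b" using w r by (auto simp: b_def)
    have wA: "w \<in> ?A" using w r by auto
    define g where "g \<zeta> = (if \<zeta> = w then deriv (\<lambda>z. f z - f w) w else (f \<zeta> - f w) / (\<zeta> - w))" for \<zeta>
    have g_hol: "g holomorphic_on ?A"
      by (rule pole_theorem_open_0[of "\<lambda>z. f z - f w" _ w])
         (use opA f in \<open>auto simp: g_def intro!: holomorphic_intros\<close>)
    have gi: "contour_integral (circlepath 0 a) g = contour_integral (circlepath 0 a) (\<lambda>\<zeta>. f \<zeta> / (\<zeta> - w))
               - f w * (if norm w < a then ?p else 0)" if a: "r < a" "a < R" "a \<noteq> norm w" for a
    proof -
      have a0: "a > 0" using a r by simp
      have "((\<lambda>\<zeta>. f \<zeta> / (\<zeta> - w) - f w * (1 / (\<zeta> - w))) has_contour_integral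
          (contour_integral (circlepath 0 a) (\<lambda>\<zeta>. f \<zeta> / (\<zeta> - w)) - f w * (if norm w < a then ?p else 0))) (circlepath 0 a)"
        by (intro has_contour_integral_diff has_contour_integral_lmul has_contour_integral_integral intw circlepath_Cauchy_kernel)
           (use a a0 in auto)
      then have "(g has_contour_integral
          (contour_integral (circlepath 0 a) (\<lambda>\<zeta>. f \<zeta> / (\<zeta> - w)) - f w * (if norm w < a then ?p else 0))) (circlepath 0 a)"
      proof (rule has_contour_integral_eq)
        fix x assume "x \<in> path_image (circlepath 0 a)"
        then have "x \<noteq> w" using a a0 by auto
        then show "f x / (x - w) - f w * (1 / (x - w)) = g x" by (simp add: g_def diff_divide_distrib)
      qed
      then show ?thesis by (rule contour_integral_unique)
    qed
    have "contour_integral (circlepath 0 b) g = contour_integral (circlepath 0 \<rho>) g"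
      by (rule contour_integral_circlepath_indep[OF g_hol]) (use b r in auto)
    then have "contour_integral (circlepath 0 b) (\<lambda>\<zeta>. f \<zeta> / (\<zeta> - w)) - f w * ?p
                = contour_integral (circlepath 0 \<rho>) (\<lambda>\<zeta>. f \<zeta> / (\<zeta> - w))"
      using b w r by (simp add: gi)
    then have "f w = contour_integral (circlepath 0 b) (\<lambda>\<zeta>. f \<zeta> / (\<zeta> - w)) / ?p + h w"
      unfolding h_def by (simp add: divide_simps) (metis diff_diff_eq2 add_diff_cancel_left')
    also have "contour_integral (circlepath 0 b) (\<lambda>\<zeta>. f \<zeta> / (\<zeta> - w)) / ?p = (\<Sum>n. c n * w ^ n)"
      using sums[OF b(3,2,1)] by (rule sums_unique)
    finally show "f w = (\<Sum>n. c n * w ^ n) + h w" .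
  qed
qed

section \<open>Means of almost periodic sums\<close>

text \<open>
  Integrate over \<open>{a..a + K}\<close>. The term of frequency \<open>0\<close> contributes \<open>K * d k0\<close>, whereas every other term integrates to at
  most \<open>2 * norm (d k) / \<eta>\<close>, independently of \<open>a\<close> and \<open>K\<close>. So \<open>norm (d k0)\<close> is at most the supremum of the sum on the
  interval plus \<open>O(1 / K)\<close>.
\<close>
lemma almost_periodic_coeff_zero:
  fixes d :: "'a \<Rightarrow> complex" and \<omega> :: "'a \<Rightarrow> real"
  assumes d: "(\<lambda>k. norm (d k)) summable_on X"
      and k0: "k0 \<in> X" "\<omega> k0 = 0"
      and gap: "0 < \<eta>" "\<And>k. k \<in> X \<Longrightarrow> k \<noteq> k0 \<Longrightarrow> \<eta> \<le> \<bar>\<omega> k\<bar>"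
      and small: "\<And>\<epsilon> K. 0 < \<epsilon> \<Longrightarrow> 0 < K \<Longrightarrow>
                    \<exists>a. \<forall>\<sigma>\<in>{a..a+K}. norm (\<Sum>\<^sub>\<infinity>k\<in>X. d k * cis (\<omega> k * \<sigma>)) \<le> \<epsilon>"
  shows "d k0 = 0"
proof (rule ccontr)
  assume d0: "d k0 \<noteq> 0"
  define S where "S = (\<Sum>\<^sub>\<infinity>k\<in>X. norm (d k))"
  have S: "(\<Sum>k\<in>Y. norm (d k)) \<le> S" if "finite Y" "Y \<subseteq> X" for Y
    unfolding S_def by (rule finite_sum_le_infsum[OF d that]) auto
  have S0: "0 \<le> S" using S[of "{}"] by simp
  \<comment> \<open>large enough for the non-resonant terms, of total size \<open>2 * S / \<eta>\<close>, to stay below \<open>K * norm (d k0) / 2\<close>\<close>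
  define K where "K = 2 * (2 * S / \<eta> + 1) / norm (d k0)"
  have K: "K > 0" using S0 gap d0 unfolding K_def by (intro divide_pos_pos mult_pos_pos add_nonneg_pos) auto
  obtain a where a: "\<And>\<sigma>. \<sigma> \<in> {a..a+K} \<Longrightarrow> norm (\<Sum>\<^sub>\<infinity>k\<in>X. d k * cis (\<omega> k * \<sigma>)) \<le> norm (d k0) / 2"
    using small[of "norm (d k0) / 2" K] d0 K by (metis half_gt_zero zero_less_norm_iff)
  have ul: "uniform_limit (cbox a (a+K)) (\<lambda>Y \<sigma>. \<Sum>k\<in>Y. d k * cis (\<omega> k * \<sigma>))
     (\<lambda>\<sigma>. \<Sum>\<^sub>\<infinity>k\<in>X. d k * cis (\<omega> k * \<sigma>)) (finite_subsets_at_top X)"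
    by (rule Weierstrass_m_test_general[OF _ d]) (auto simp: norm_mult)
  obtain I J where I: "\<And>Y. ((\<lambda>\<sigma>. \<Sum>k\<in>Y. d k * cis (\<omega> k * \<sigma>)) has_integral I Y) (cbox a (a+K))"
    and J: "((\<lambda>\<sigma>. \<Sum>\<^sub>\<infinity>k\<in>X. d k * cis (\<omega> k * \<sigma>)) has_integral J) (cbox a (a+K))"
    and IJ: "(I \<longlongrightarrow> J) (finite_subsets_at_top X)"
    by (rule uniform_limit_integral_cbox[OF ul]) (auto intro!: continuous_intros)
  have normJ: "norm J \<le> norm (d k0) / 2 * K"
    using has_integral_bound[OF _ J, of "norm (d k0) / 2"] a K d0 by simp
  define T where "T k = d k * (cis (\<omega> k * (a+K)) - cis (\<omega> k * a)) / (\<i> * \<omega> k)" for k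
  have T: "((\<lambda>\<sigma>. d k * cis (\<omega> k * \<sigma>)) has_integral T k) (cbox a (a+K))" if "\<omega> k \<noteq> 0" for k
  proof -
    have "((\<lambda>\<sigma>. d k * cis (\<omega> k * \<sigma>)) has_integral
       (d k * cis (\<omega> k * (a+K)) / (\<i> * \<omega> k) - d k * cis (\<omega> k * a) / (\<i> * \<omega> k))) {a..a+K}"
    proof (rule fundamental_theorem_of_calculus)
      fix x assume "x \<in> {a..a+K}"
      show "((\<lambda>\<sigma>. d k * cis (\<omega> k * \<sigma>) / (\<i> * \<omega> k)) has_vector_derivative d k * cis (\<omega> k * x)) (at x within {a..a+K})"
        unfolding cis_conv_exp of_real_mult
      proof (rule has_vector_derivative_real_field)
        show "((\<lambda>z. d k * exp (\<i> * (of_real (\<omega> k) * z)) / (\<i> * of_real (\<omega> k))) has_field_derivative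
            d k * exp (\<i> * (of_real (\<omega> k) * of_real x))) (at (of_real x))"
          using that by (auto intro!: derivative_eq_intros) (simp add: mult.commute[of _ "\<i> * d k"] mult.assoc)
      qed
    qed (use K in auto)
    then show ?thesis by (simp add: T_def diff_divide_distrib right_diff_distrib)
  qed
  have normT: "norm (T k) \<le> 2 / \<eta> * norm (d k)" if "k \<in> X" "k \<noteq> k0" for k
  proof -
    have \<omega>: "\<eta> \<le> \<bar>\<omega> k\<bar>" using gap that by auto
    have "norm (cis (\<omega> k * (a+K)) - cis (\<omega> k * a)) \<le> 2"
      using norm_triangle_ineq4[of "cis (\<omega> k * (a+K))" "cis (\<omega> k * a)"] by simp
    then have "norm (T k) \<le> norm (d k) * 2 / \<bar>\<omega> k\<bar>"
      unfolding T_def norm_mult norm_divide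
      by (auto intro!: divide_right_mono mult_left_mono)
    also have "\<dots> \<le> norm (d k) * 2 / \<eta>"
      using \<omega> gap by (intro divide_left_mono mult_pos_pos) auto
    finally show ?thesis by (simp add: mult_ac)
  qed
  have "norm (I Y - of_real K * d k0) \<le> 2 / \<eta> * S" if Y: "finite Y" "Y \<subseteq> X" "k0 \<in> Y" for Y
  proof -
    have "((\<lambda>\<sigma>. d k0 * cis (\<omega> k0 * \<sigma>)) has_integral (of_real K * d k0)) (cbox a (a+K))"
      using has_integral_const_real[of "d k0" a "a+K"] K k0 by (simp add: scaleR_conv_of_real)
    moreover have "((\<lambda>\<sigma>. \<Sum>k\<in>Y-{k0}. d k * cis (\<omega> k * \<sigma>)) has_integral (\<Sum>k\<in>Y-{k0}. T k)) (cbox a (a+K))"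
      using Y gap by (intro has_integral_sum T) force+
    ultimately have "((\<lambda>\<sigma>. d k0 * cis (\<omega> k0 * \<sigma>) + (\<Sum>k\<in>Y-{k0}. d k * cis (\<omega> k * \<sigma>))) has_integral
        (of_real K * d k0 + (\<Sum>k\<in>Y-{k0}. T k))) (cbox a (a+K))"
      by (rule has_integral_add)
    moreover have "d k0 * cis (\<omega> k0 * \<sigma>) + (\<Sum>k\<in>Y-{k0}. d k * cis (\<omega> k * \<sigma>)) = (\<Sum>k\<in>Y. d k * cis (\<omega> k * \<sigma>))" for \<sigma>
      using Y by (simp add: sum.remove)
    ultimately have "I Y = of_real K * d k0 + (\<Sum>k\<in>Y-{k0}. T k)"
      using has_integral_unique[OF I] by simp
    then have "norm (I Y - of_real K * d k0) = norm (\<Sum>k\<in>Y-{k0}. T k)" by simp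
    also have "\<dots> \<le> (\<Sum>k\<in>Y-{k0}. 2 / \<eta> * norm (d k))"
      using Y by (intro sum_norm_le normT) auto
    also have "\<dots> = 2 / \<eta> * (\<Sum>k\<in>Y-{k0}. norm (d k))" by (rule sum_distrib_left[symmetric])
    also have "\<dots> \<le> 2 / \<eta> * S" using gap Y by (intro mult_left_mono S) auto
    finally show ?thesis .
  qed
  then have "\<forall>\<^sub>F Y in finite_subsets_at_top X. norm (I Y - of_real K * d k0) \<le> 2 / \<eta> * S"
    using k0 unfolding eventually_finite_subsets_at_top by (intro exI[of _ "{k0}"]) auto
  then have "norm (J - of_real K * d k0) \<le> 2 / \<eta> * S"
    by (intro tendsto_upperbound[OF tendsto_norm[OF tendsto_diff[OF IJ tendsto_const]]]) auto
  then have "norm (of_real K * d k0) \<le> 2 / \<eta> * S + norm J"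
    using norm_triangle_ineq4[of J "J - of_real K * d k0"] by simp
  then have "K * norm (d k0) \<le> 2 / \<eta> * S + norm (d k0) / 2 * K"
    using normJ K by (simp add: norm_mult)
  moreover have "K * norm (d k0) = 2 * (2 * S / \<eta> + 1)" unfolding K_def using d0 by simp
  ultimately show False by (simp add: field_simps)
qed

section \<open>The periodized Gamma integrand\<close>

text \<open>
  The integrand of Euler's integral for \<open>\<Gamma>(\<beta>)\<close> after the substitution \<open>t = e\<^sup>y\<close>, which absorbs the
  factor \<open>dt = e\<^sup>y dy\<close>.
\<close>
definition log_integrand :: "complex \<Rightarrow> complex \<Rightarrow> complex" where
  "log_integrand \<beta> y = exp (\<beta> * y - exp y)"

definition log_period_sum :: "complex \<Rightarrow> real \<Rightarrow> complex \<Rightarrow> complex" where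
  "log_period_sum \<beta> P y = (\<Sum>\<^sub>\<infinity>k::int. log_integrand \<beta> (y + of_real (of_int k * P)))"

lemma summable_on_exp_neg_abs_int:
  assumes "0 < (q::real)"
  shows "(\<lambda>k::int. exp (- q * \<bar>of_int k\<bar>)) summable_on UNIV"
proof -
  have g: "(\<lambda>n::nat. exp (- q) ^ n) summable_on UNIV"
    by (rule summable_nonneg_imp_summable_on) (use assms in \<open>auto intro!: summable_geometric\<close>)
  have "exp (- q) ^ n = exp (- q * real n)" for n
    by (metis exp_of_nat_mult mult.commute)
  then have g: "(\<lambda>n::nat. exp (- q * real n)) summable_on UNIV"
    using g by simp
  have "(\<lambda>k::int. exp (- q * \<bar>of_int k\<bar>)) summable_on (range int)"
    by (subst summable_on_reindex) (use g in \<open>simp_all add: o_def\<close>)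
  moreover have "(\<lambda>k::int. exp (- q * \<bar>of_int k\<bar>)) summable_on (range (\<lambda>n. - int n))"
    by (subst summable_on_reindex) (use g in \<open>simp_all add: o_def inj_def\<close>)
  ultimately have "(\<lambda>k::int. exp (- q * \<bar>of_int k\<bar>)) summable_on (range int \<union> range (\<lambda>n. - int n))"
    by (rule summable_on_union)
  moreover have "range int \<union> range (\<lambda>n. - int n) = UNIV"
    by (auto simp: image_iff) (metis int_cases2)
  ultimately show ?thesis by simp
qed

text \<open>
  To the left, the factor \<open>exp (\<beta> y)\<close> decays because \<open>Re \<beta> > 0\<close>. To the right,
  \<open>Re (e\<^sup>y) = e\<^bsup>Re y\<^esup> cos (Im y)\<close> grows exponentially, with a cosine bounded below as long as \<open>y\<close> stays away from the edges
  of the strip \<open>|Im y| < \<pi> / 2\<close>.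
\<close>
lemma log_integrand_bound:
  assumes "0 < Re \<beta>" "t < pi / 2"
  obtains C b where "0 < b" "0 \<le> C"
    "\<And>y. \<bar>Im y\<bar> \<le> t \<Longrightarrow> norm (log_integrand \<beta> y) \<le> C * exp (- b * \<bar>Re y\<bar>)"
proof -
  define b where "b = Re \<beta>"
  have b: "b > 0" using assms by (simp add: b_def)
  define \<kappa> where "\<kappa> = cos (max t 0)"
  have t: "0 \<le> max t 0" "max t 0 < pi / 2" using assms by (auto simp: max_def)
  have \<kappa>: "\<kappa> > 0" unfolding \<kappa>_def by (rule cos_gt_zero_pi) (use t in linarith)+
  obtain m :: nat where m: "2 * b \<le> real m" using real_arch_simple by blast
  define C where "C = exp (\<bar>Im \<beta>\<bar> * max t 0) * (1 + fact m / \<kappa> ^ m)"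
  have "norm (log_integrand \<beta> y) \<le> C * exp (- b * \<bar>Re y\<bar>)" if y: "\<bar>Im y\<bar> \<le> t" for y
  proof -
    define x where "x = Re y"
    have cosy: "\<kappa> \<le> cos (Im y)"
    proof -
      have "cos (max t 0) \<le> cos \<bar>Im y\<bar>"
        using y assms by (intro cos_monotone_0_pi_le) auto
      then show ?thesis by (simp add: \<kappa>_def)
    qed
    have "norm (log_integrand \<beta> y) = exp (b * x - Im \<beta> * Im y - exp x * cos (Im y))"
      by (simp add: log_integrand_def b_def x_def Re_exp)
    also have "\<dots> \<le> exp (b * x + \<bar>Im \<beta>\<bar> * max t 0 - exp x * \<kappa>)"
    proof -
      have "- (Im \<beta> * Im y) \<le> \<bar>Im \<beta>\<bar> * \<bar>Im y\<bar>" by (metis abs_ge_minus_self abs_mult)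
      also have "\<dots> \<le> \<bar>Im \<beta>\<bar> * max t 0" using y by (intro mult_left_mono) auto
      finally show ?thesis using cosy by (simp add: mult_left_mono add_mono diff_mono)
    qed
    also have "\<dots> = exp (\<bar>Im \<beta>\<bar> * max t 0) * (exp (b * x) * exp (- (\<kappa> * exp x)))"
      by (simp add: exp_add[symmetric] algebra_simps)
    also have "exp (b * x) * exp (- (\<kappa> * exp x)) \<le> (1 + fact m / \<kappa> ^ m) * exp (- b * \<bar>x\<bar>)"
    proof (cases "x \<ge> 0")
      case False
      have "exp (b * x) * exp (- (\<kappa> * exp x)) \<le> exp (b * x) * 1"
        using \<kappa> by (intro mult_left_mono) auto
      also have "\<dots> \<le> (1 + fact m / \<kappa> ^ m) * exp (- b * \<bar>x\<bar>)"
        using False \<kappa> by (simp add: mult_le_cancel_right1)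
      finally show ?thesis .
    next
      case True
      \<comment> \<open>the double exponential beats every power of \<open>exp x\<close>\<close>
      have "(\<kappa> * exp x) ^ m / fact m \<le> exp (\<kappa> * exp x)"
      proof -
        define z where "z = \<kappa> * exp x"
        have z: "(\<lambda>n. z ^ n /\<^sub>R fact n) sums exp z" "0 \<le> z"
          using \<kappa> by (auto simp: z_def intro: exp_converges simp del: real_scaleR_def)
        have "sum (\<lambda>n. z ^ n /\<^sub>R fact n) {m} \<le> (\<Sum>n. z ^ n /\<^sub>R fact n)"
          by (rule sum_le_suminf[OF sums_summable[OF z(1)]]) (use z(2) in auto)
        then have "z ^ m /\<^sub>R fact m \<le> exp z"
          unfolding sums_unique[OF z(1), symmetric] by simp
        then have "(\<kappa> * exp x) ^ m /\<^sub>R fact m \<le> exp (\<kappa> * exp x)"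
          by (simp add: z_def)
        then show ?thesis by (simp add: divide_inverse mult.commute)
      qed
      then have "exp (- (\<kappa> * exp x)) \<le> fact m / (\<kappa> * exp x) ^ m"
        using \<kappa> by (simp add: exp_minus field_simps)
      then have "exp (b * x) * exp (- (\<kappa> * exp x)) \<le> exp (b * x) * (fact m / (\<kappa> * exp x) ^ m)"
        by (intro mult_left_mono) auto
      also have "\<dots> = fact m / \<kappa> ^ m * exp (b * x - real m * x)"
        by (simp add: power_mult_distrib exp_diff exp_of_nat_mult)
      also have "\<dots> \<le> (1 + fact m / \<kappa> ^ m) * exp (- b * \<bar>x\<bar>)"
      proof (rule mult_mono)
        have "2 * b * x \<le> real m * x" using m True by (rule mult_right_mono)
        then show "exp (b * x - real m * x) \<le> exp (- b * \<bar>x\<bar>)" using True by simp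
      qed (use \<kappa> in auto)
      finally show ?thesis .
    qed
    finally show ?thesis by (simp add: C_def x_def mult_ac)
  qed
  moreover have "0 \<le> C" using \<kappa> by (auto simp: C_def)
  ultimately show ?thesis using that b by blast
qed

lemma log_integrand_shift_majorant:
  assumes "0 < Re \<beta>" "t < pi / 2" "0 < P"
  obtains M :: "int \<Rightarrow> real" where "M summable_on UNIV"
    "\<And>y k. \<bar>Im y\<bar> \<le> t \<Longrightarrow> \<bar>Re y\<bar> \<le> A \<Longrightarrow> norm (log_integrand \<beta> (y + of_real (of_int k * P))) \<le> M k"
proof -
  obtain C b where C: "0 < b" "0 \<le> C"
    "\<And>y. \<bar>Im y\<bar> \<le> t \<Longrightarrow> norm (log_integrand \<beta> y) \<le> C * exp (- b * \<bar>Re y\<bar>)"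
    using log_integrand_bound[OF assms(1,2)] by metis
  define M where "M k = C * exp (b * A) * exp (- (b * P) * \<bar>of_int k\<bar>)" for k :: int
  show ?thesis
  proof (rule that)
    show "M summable_on UNIV" unfolding M_def
      by (intro summable_on_cmult_right summable_on_exp_neg_abs_int) (use C assms in auto)
    fix y k assume y: "\<bar>Im y\<bar> \<le> t" "\<bar>Re y\<bar> \<le> A"
    have "\<bar>of_int k\<bar> * P = \<bar>of_int k * P\<bar>" using assms by (simp add: abs_mult)
    also have "\<dots> \<le> \<bar>Re y + of_int k * P\<bar> + A" using y by linarith
    finally have "b * (\<bar>of_int k\<bar> * P) \<le> b * (\<bar>Re y + of_int k * P\<bar> + A)" using C by (intro mult_left_mono) auto
    then have e: "- b * \<bar>Re y + of_int k * P\<bar> \<le> b * A + - (b * P) * \<bar>of_int k\<bar>" by (simp add: algebra_simps)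
    have "norm (log_integrand \<beta> (y + of_real (of_int k * P))) \<le> C * exp (- b * \<bar>Re y + of_int k * P\<bar>)"
      using C(3)[of "y + of_real (of_int k * P)"] y by simp
    also have "\<dots> \<le> C * exp (b * A + - (b * P) * \<bar>of_int k\<bar>)"
      using e C by (intro mult_left_mono) auto
    also have "\<dots> = M k" unfolding M_def exp_add by simp
    finally show "norm (log_integrand \<beta> (y + of_real (of_int k * P))) \<le> M k" .
  qed
qed

lemma log_period_sum_uniform_limit:
  assumes "0 < Re \<beta>" "0 < P" "t < pi / 2" 
    "\<And>y. y \<in> Y \<Longrightarrow> \<bar>Im y\<bar> \<le> t" "\<And>y. y \<in> Y \<Longrightarrow> \<bar>Re y\<bar> \<le> A"
  shows "uniform_limit Y (\<lambda>X y. \<Sum>k\<in>X. log_integrand \<beta> (y + of_real (of_int k * P))) (log_period_sum \<beta> P) (finite_subsets_at_top UNIV)"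
proof -
  obtain M :: "int \<Rightarrow> real" where M: "M summable_on UNIV"
    "\<And>y k. \<bar>Im y\<bar> \<le> t \<Longrightarrow> \<bar>Re y\<bar> \<le> A \<Longrightarrow> norm (log_integrand \<beta> (y + of_real (of_int k * P))) \<le> M k"
    using log_integrand_shift_majorant[OF assms(1,3,2)] by metis
  show ?thesis unfolding log_period_sum_def
    by (rule Weierstrass_m_test_general[OF _ M(1)]) (use M(2) assms in auto)
qed

lemma log_period_sum_abs_summable:
  assumes "0 < Re \<beta>" "0 < P" "\<bar>Im y\<bar> < pi / 2"
  shows "(\<lambda>k::int. norm (log_integrand \<beta> (y + of_real (of_int k * P)))) summable_on UNIV"
proof -
  obtain M :: "int \<Rightarrow> real" where M: "M summable_on UNIV"
    "\<And>z k. \<bar>Im z\<bar> \<le> \<bar>Im y\<bar> \<Longrightarrow> \<bar>Re z\<bar> \<le> \<bar>Re y\<bar> \<Longrightarrow> norm (log_integrand \<beta> (z + of_real (of_int k * P))) \<le> M k"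
    using log_integrand_shift_majorant[OF assms(1,3,2)] by metis
  show ?thesis
    by (rule summable_on_comparison_test[OF M(1)]) (use M(2) in auto)
qed

lemma log_period_sum_periodic: "log_period_sum \<beta> P (y + of_real (of_int m * P)) = log_period_sum \<beta> P y"
proof -
  define F where "F k = log_integrand \<beta> (y + of_real (of_int k * P))" for k :: int
  have "log_period_sum \<beta> P (y + of_real (of_int m * P)) = (\<Sum>\<^sub>\<infinity>k. F (m + k))"
    by (simp add: log_period_sum_def F_def algebra_simps)
  also have "\<dots> = (\<Sum>\<^sub>\<infinity>k. F k)"
    by (rule infsum_reindex_bij_betw) (simp add: bij_plus_right)
  finally show ?thesis by (simp add: log_period_sum_def F_def)
qed

lemma log_period_sum_holomorphic:
  assumes "0 < Re \<beta>" "0 < P"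
  shows "log_period_sum \<beta> P holomorphic_on {y. \<bar>Im y\<bar> < pi / 2}"
proof -
  have "log_period_sum \<beta> P field_differentiable at y" if y: "\<bar>Im y\<bar> < pi / 2" for y
  proof -
    define e where "e = (pi / 2 - \<bar>Im y\<bar>) / 2"
    have e: "e > 0" using y by (simp add: e_def)
    have ul: "uniform_limit (cball y e) (\<lambda>X y. \<Sum>k\<in>X. log_integrand \<beta> (y + of_real (of_int k * P))) (log_period_sum \<beta> P) (finite_subsets_at_top UNIV)"
    proof (rule log_period_sum_uniform_limit[OF assms])
      show "\<bar>Im y\<bar> + e < pi / 2" using y by (simp add: e_def field_simps)
      fix z assume "z \<in> cball y e"
      then have "norm (z - y) \<le> e" by (simp add: dist_norm norm_minus_commute)
      then have "\<bar>Im (z - y)\<bar> \<le> e" "\<bar>Re (z - y)\<bar> \<le> e" using abs_Im_le_cmod abs_Re_le_cmod order_trans by blast+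
      then show "\<bar>Im z\<bar> \<le> \<bar>Im y\<bar> + e" "\<bar>Re z\<bar> \<le> \<bar>Re y\<bar> + e" by auto
    qed
    have "\<forall>\<^sub>F X in finite_subsets_at_top UNIV.
            continuous_on (cball y e) (\<lambda>y. \<Sum>k\<in>X. log_integrand \<beta> (y + of_real (of_int k * P))) \<and>
            (\<lambda>y. \<Sum>k\<in>X. log_integrand \<beta> (y + of_real (of_int k * P))) holomorphic_on ball y e"
      unfolding log_integrand_def by (intro always_eventually allI conjI holomorphic_intros continuous_intros)
    then have "log_period_sum \<beta> P holomorphic_on ball y e"
      by (rule holomorphic_uniform_limit[OF _ ul]) auto
    then show ?thesis using e by (simp add: holomorphic_on_def at_within_open[of y "ball y e"])
       (metis at_within_open centre_in_ball open_ball)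
  qed
  then show ?thesis by (simp add: holomorphic_on_def field_differentiable_at_within)
qed

section \<open>Unboundedness at the edge of the strip\<close>

text \<open>
  Suppose \<open>M\<close> bounds the function near \<open>y0\<close>. For \<open>\<tau> = 1 - i \<sigma>\<close> with \<open>\<sigma>\<close> within \<open>K\<close> of \<open>exp (Re y0 + m P)\<close>, the rescaled
  point \<open>e\<^bsup>- m P\<^esup> \<tau>\<close> tends to \<open>exp y0\<close> as \<open>m\<close> grows, so its logarithm enters the given neighbourhood of \<open>y0\<close>;
  by periodicity the bound \<open>M\<close> also holds at \<open>y = Ln \<tau>\<close>. Factoring \<open>exp (\<beta> y)\<close> and \<open>cis \<sigma>\<close> out of the sum
  leaves an almost periodic sum in \<open>\<sigma>\<close> whose term \<open>k = 0\<close> is the constant \<open>e\<^sup>-\<^sup>1\<close>. The factor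
  \<open>exp (\<beta> y)\<close> is large there, so this sum is arbitrarily small on intervals of any length \<open>K\<close>,
  and \<open>almost_periodic_coeff_zero\<close> would give \<open>e\<^sup>-\<^sup>1 = 0\<close>.
\<close>
lemma log_period_sum_unbounded:
  assumes "0 < Re \<beta>" "0 < P" "Im y0 = - pi / 2" "0 < r"
  obtains y where "y \<in> ball y0 r" "\<bar>Im y\<bar> < pi / 2" "M < norm (log_period_sum \<beta> P y)"
proof (rule ccontr)
  assume "\<not> thesis"
  then have bdd: "norm (log_period_sum \<beta> P y) \<le> M" if "y \<in> ball y0 r" "\<bar>Im y\<bar> < pi / 2" for y
    using that(1) that(2) \<open>\<And>y. y \<in> ball y0 r \<Longrightarrow> \<bar>Im y\<bar> < pi / 2 \<Longrightarrow> M < norm (log_period_sum \<beta> P y) \<Longrightarrow> thesis\<close>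
    by (meson not_le)
  define d where "d k = log_integrand \<beta> (of_real (of_int k * P))" for k :: int
  define \<omega> where "\<omega> k = exp (of_int k * P) - 1" for k :: int
  define \<sigma>0 where "\<sigma>0 = exp (Re y0)"
  have "d 0 = 0"
  proof (rule almost_periodic_coeff_zero[of d UNIV 0 \<omega> "min (exp P - 1) (1 - exp (- P))"])
    show "(\<lambda>k. norm (d k)) summable_on UNIV"
      using log_period_sum_abs_summable[OF assms(1,2), of 0] by (simp add: d_def)
    show "0 < min (exp P - 1) (1 - exp (- P))" using assms by simp
    show "min (exp P - 1) (1 - exp (- P)) \<le> \<bar>\<omega> k\<bar>" if "k \<noteq> 0" for k
    proof (cases "k > 0")
      case True
      then have "1 * P \<le> of_int k * P" using assms by (intro mult_right_mono) auto
      then have "exp P \<le> exp (of_int k * P)" by (simp only: exp_le_cancel_iff mult_1)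
      then have "exp P - 1 \<le> \<bar>\<omega> k\<bar>" unfolding \<omega>_def by linarith
      then show ?thesis by (rule min.coboundedI1)
    next
      case False
      then have "of_int k \<le> (-1::real)" using that by linarith
      then have "of_int k * P \<le> (-1) * P" using assms by (intro mult_right_mono) auto
      then have "exp (of_int k * P) \<le> exp (- P)" by (simp only: exp_le_cancel_iff mult_minus1)
      then have "1 - exp (- P) \<le> \<bar>\<omega> k\<bar>" unfolding \<omega>_def by linarith
      then show ?thesis by (rule min.coboundedI2)
    qed
    fix \<epsilon> K :: real assume "0 < \<epsilon>" "0 < K"
    \<comment> \<open>\<open>- i \<sigma>0 = exp y0\<close> because \<open>Im y0 = - \<pi> / 2\<close>\<close>
    have "isCont Ln (- \<i> * of_real \<sigma>0)"
      by (intro continuous_at_Ln) (auto simp: complex_nonpos_Reals_iff \<sigma>0_def)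
    moreover have "Ln (- \<i> * of_real \<sigma>0) = y0"
    proof -
      have "exp y0 = of_real \<sigma>0 * cis (Im y0)"
        by (metis \<sigma>0_def exp_eq_polar)
      also have "\<dots> = - \<i> * of_real \<sigma>0" using assms by (simp add: complex_eq_iff)
      finally have "Ln (- \<i> * of_real \<sigma>0) = Ln (exp y0)" by simp
      also have "\<dots> = y0" by (rule Ln_exp) (use assms pi_gt_zero in linarith)+
      finally show ?thesis .
    qed
    ultimately obtain \<delta> where \<delta>: "\<delta> > 0"
      "\<And>w. dist w (- \<i> * of_real \<sigma>0) < \<delta> \<Longrightarrow> dist (Ln w) y0 < r"
      unfolding continuous_at_eps_delta using \<open>0 < r\<close> by (metis (no_types, lifting))
    have exp0: "(\<lambda>m. exp (- (real m * q))) \<longlonglongrightarrow> 0" if "q > 0" for q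
      by (rule filterlim_compose[OF exp_at_bot], subst filterlim_uminus_at_bot, simp,
          rule filterlim_at_top_mult_tendsto_pos[OF tendsto_const that filterlim_real_sequentially])
    have "(\<lambda>m. exp (- real m * P) * (1 + K)) \<longlonglongrightarrow> 0"
      using tendsto_mult_left_zero[OF exp0[OF \<open>0 < P\<close>]] by simp
    then have ev1: "\<forall>\<^sub>F m in sequentially. exp (- real m * P) * (1 + K) < \<delta>"
      using \<delta>(1) by (rule order_tendstoD)
    have "(\<lambda>m. \<bar>M\<bar> * exp (\<bar>Im \<beta>\<bar> * pi / 2 - Re \<beta> * (Re y0 + real m * P))) \<longlonglongrightarrow> 0" 
    proof -
      have "(\<lambda>m. \<bar>M\<bar> * exp (\<bar>Im \<beta>\<bar> * pi / 2 - Re \<beta> * Re y0) * exp (- (real m * (Re \<beta> * P)))) \<longlonglongrightarrow> 0"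
        using assms by (intro tendsto_mult_right_zero exp0) auto
      then show ?thesis by (simp add: mult.assoc exp_add[symmetric] algebra_simps)
    qed
    then have ev2: "\<forall>\<^sub>F m in sequentially. \<bar>M\<bar> * exp (\<bar>Im \<beta>\<bar> * pi / 2 - Re \<beta> * (Re y0 + real m * P)) < \<epsilon>"
      using \<open>0 < \<epsilon>\<close> by (rule order_tendstoD)
    obtain m where m: "exp (- real m * P) * (1 + K) < \<delta>"
      "\<bar>M\<bar> * exp (\<bar>Im \<beta>\<bar> * pi / 2 - Re \<beta> * (Re y0 + real m * P)) < \<epsilon>"
      using eventually_happens[OF eventually_conj[OF ev1 ev2]] by auto
    define a where "a = exp (Re y0 + real m * P)"
    have "norm (\<Sum>\<^sub>\<infinity>k. d k * cis (\<omega> k * \<sigma>)) \<le> \<epsilon>" if \<sigma>: "\<sigma> \<in> {a..a+K}" for \<sigma>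
    proof -
      define E where "E = exp (- real m * P)"
      have E: "E > 0" by (simp add: E_def)
      have Ea: "E * a = \<sigma>0" by (simp add: E_def a_def \<sigma>0_def exp_add[symmetric] exp_minus[symmetric])
      \<comment> \<open>the point \<open>\<tau> = 1 - i \<sigma>\<close> scaled back next to \<open>exp y0\<close>\<close>
      define w where "w = of_real E * (1 - \<i> * of_real \<sigma>)"
      define y where "y = Ln w + of_real (of_int (int m) * P)"
      have Rew: "Re w = E" and Imw: "Im w = - E * \<sigma>" by (auto simp: w_def)
      have w0: "w \<noteq> 0" using Rew E by auto
      have "dist w (- \<i> * of_real \<sigma>0) = norm (of_real E * (1 - \<i> * of_real (\<sigma> - a)))"
        by (simp add: w_def dist_norm Ea[symmetric] algebra_simps)
      also have "\<dots> = E * norm (1 - \<i> * of_real (\<sigma> - a))" using E by (simp add: norm_mult)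
      also have "norm (1 - \<i> * of_real (\<sigma> - a)) \<le> 1 + K"
        using norm_triangle_ineq4[of 1 "\<i> * of_real (\<sigma> - a)"] \<sigma> by (simp add: norm_mult del: of_real_diff)
      finally have "dist w (- \<i> * of_real \<sigma>0) < \<delta>" using m(1) E by (simp add: E_def)
      then have "Ln w \<in> ball y0 r" using \<delta>(2) by (simp add: dist_commute)
      moreover have Imy: "\<bar>Im (Ln w)\<bar> < pi / 2" using Re_Ln_pos_lt[OF w0] Rew E by simp
      ultimately have gb: "norm (log_period_sum \<beta> P y) \<le> \<bar>M\<bar>"
        using bdd unfolding y_def log_period_sum_periodic by (meson abs_ge_self order_trans)
      have expy: "exp y = 1 - \<i> * of_real \<sigma>"
      proof -
        have "exp y = exp (Ln w) * exp (of_real (real m * P))" unfolding y_def exp_add by simp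
        also have "\<dots> = w * of_real (exp (real m * P))" by (simp only: exp_of_real exp_Ln[OF w0])
        also have "\<dots> = of_real (E * exp (real m * P)) * (1 - \<i> * of_real \<sigma>)" by (simp add: w_def)
        also have "E * exp (real m * P) = 1" by (simp add: E_def exp_add[symmetric])
        finally show ?thesis by simp
      qed
      have summand: "log_integrand \<beta> (y + of_real (of_int k * P)) = exp (\<beta> * y) * cis \<sigma> * (d k * cis (\<omega> k * \<sigma>))" for k
      proof -
        define p where "p = of_int k * P"
        have ey: "exp (y + of_real p) = (1 - \<i> * of_real \<sigma>) * of_real (exp p)"
          by (simp add: exp_add expy exp_of_real)
        have "log_integrand \<beta> (y + of_real p) = exp (\<beta> * y + \<beta> * of_real p - of_real (exp p) + \<i> * of_real (\<sigma> * exp p))"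
          unfolding log_integrand_def ey by (simp add: algebra_simps)
        also have "\<dots> = exp (\<beta> * y) * exp (\<beta> * of_real p - of_real (exp p)) * cis (\<sigma> + (exp p - 1) * \<sigma>)"
          by (simp add: exp_add[symmetric] cis_conv_exp algebra_simps)
        also have "\<dots> = exp (\<beta> * y) * cis \<sigma> * (d k * cis (\<omega> k * \<sigma>))"
          unfolding d_def \<omega>_def log_integrand_def p_def[symmetric] cis_mult[symmetric] exp_of_real by (simp add: mult_ac)
        finally show ?thesis unfolding p_def .
      qed
      have "log_period_sum \<beta> P y = exp (\<beta> * y) * cis \<sigma> * (\<Sum>\<^sub>\<infinity>k. d k * cis (\<omega> k * \<sigma>))"
        unfolding log_period_sum_def summand by (rule infsum_cmult_right')
      then have eq: "norm (log_period_sum \<beta> P y) = exp (Re (\<beta> * y)) * norm (\<Sum>\<^sub>\<infinity>k. d k * cis (\<omega> k * \<sigma>))"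
        by (simp add: norm_mult)
      have "Re y0 + real m * P \<le> Re y"
      proof -
        have "a \<le> \<sigma>" using \<sigma> by simp
        also have "\<sigma> \<le> norm (1 - \<i> * of_real \<sigma>)" using abs_Im_le_cmod[of "1 - \<i> * of_real \<sigma>"] by simp
        also have "\<dots> = exp (Re y)" using expy norm_exp_eq_Re by metis
        finally show ?thesis by (simp add: a_def)
      qed
      then have "Re \<beta> * (Re y0 + real m * P) \<le> Re \<beta> * Re y" using assms by (intro mult_left_mono) auto
      moreover have "Im \<beta> * Im y \<le> \<bar>Im \<beta>\<bar> * pi / 2"
      proof -
        have "Im \<beta> * Im y \<le> \<bar>Im \<beta>\<bar> * \<bar>Im y\<bar>" by (metis abs_ge_self abs_mult)
        also have "\<dots> \<le> \<bar>Im \<beta>\<bar> * (pi / 2)" using Imy by (intro mult_left_mono) (auto simp: y_def)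
        finally show ?thesis by simp
      qed
      ultimately have "- Re (\<beta> * y) \<le> \<bar>Im \<beta>\<bar> * pi / 2 - Re \<beta> * (Re y0 + real m * P)" by simp
      then have e: "exp (- Re (\<beta> * y)) \<le> exp (\<bar>Im \<beta>\<bar> * pi / 2 - Re \<beta> * (Re y0 + real m * P))" by simp
      have "norm (\<Sum>\<^sub>\<infinity>k. d k * cis (\<omega> k * \<sigma>)) = norm (log_period_sum \<beta> P y) * exp (- Re (\<beta> * y))"
        by (simp add: eq exp_minus del: times_complex.sel)
      also have "\<dots> \<le> \<bar>M\<bar> * exp (\<bar>Im \<beta>\<bar> * pi / 2 - Re \<beta> * (Re y0 + real m * P))"
        by (intro mult_mono gb e) auto
      finally show ?thesis using m(2) by simp
    qed
    then show "\<exists>a. \<forall>\<sigma>\<in>{a..a+K}. norm (\<Sum>\<^sub>\<infinity>k. d k * cis (\<omega> k * \<sigma>)) \<le> \<epsilon>" by blast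
  qed (auto simp: \<omega>_def)
  then show False by (simp add: d_def log_integrand_def)
qed

section \<open>Laurent coefficients as Gamma values\<close>

lemma Gamma_integral_on_geometric_intervals:
  assumes z: "0 < Re z" and P: "0 < P"
  shows "(\<lambda>N. integral {exp (- (real N * P))..exp (real N * P)} (\<lambda>t. of_real t powr (z - 1) / of_real (exp t)))
           \<longlonglongrightarrow> Gamma z"
proof -
  define g where "g t = of_real t powr (z - 1) / of_real (exp t)" for t :: real
  define A where "A N = {exp (- (real N * P))..exp (real N * P)}" for N
  have gi: "(g has_integral Gamma z) {0<..}"
    using Gamma_integral_complex'[OF z] by (simp add: g_def[abs_def])
  have ga: "g absolutely_integrable_on {0<..}"
    using absolutely_integrable_Gamma_integral'[OF z] by (simp add: g_def[abs_def])
  have sub: "A N \<subseteq> {0<..}" for N by (auto simp: A_def intro: less_le_trans[OF exp_gt_zero])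
  have gA: "g integrable_on A N" for N
  proof -
    have "g absolutely_integrable_on A N"
      by (rule set_integrable_subset[OF ga _ sub]) (simp add: A_def)
    then show ?thesis by (rule set_lebesgue_integral_eq_integral(1))
  qed
  have restr: "((\<lambda>t. if t \<in> A N then g t else 0) has_integral integral (A N) g) {0<..}" for N
    unfolding has_integral_restrict[OF sub] by (rule integrable_integral[OF gA])
  have "(\<lambda>N. integral {0<..} (\<lambda>t. if t \<in> A N then g t else 0)) \<longlonglongrightarrow> integral {0<..} g"
  proof (rule dominated_convergence(2))
    show "(\<lambda>t. if t \<in> A N then g t else 0) integrable_on {0<..}" for N using restr by blast
    show "(\<lambda>t. norm (g t)) integrable_on {0<..}"
      using ga absolutely_integrable_on_def by blast
    show "(\<lambda>N. if t \<in> A N then g t else 0) \<longlonglongrightarrow> g t" if t: "t \<in> {0<..}" for t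
    proof -
      obtain N0 :: nat where N0: "\<bar>ln t\<bar> / P \<le> real N0" using real_arch_simple by blast
      have "t \<in> A N" if "N0 \<le> N" for N
      proof -
        have "\<bar>ln t\<bar> \<le> real N0 * P" using N0 P by (simp add: field_simps)
        also have "\<dots> \<le> real N * P" using that P by (intro mult_right_mono) auto
        finally have "- (real N * P) \<le> ln t" "ln t \<le> real N * P" by auto
        then have "exp (- (real N * P)) \<le> exp (ln t)" "exp (ln t) \<le> exp (real N * P)"
          by (simp_all only: exp_le_cancel_iff)
        moreover have "exp (ln t) = t" using t by simp
        ultimately show ?thesis by (simp only: A_def atLeastAtMost_iff)
      qed
      then have "\<forall>\<^sub>F N in sequentially. (if t \<in> A N then g t else 0) = g t"
        unfolding eventually_sequentially by (intro exI[of _ N0]) auto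
      then show ?thesis by (rule tendsto_eventually)
    qed
  qed auto
  moreover have "integral {0<..} (\<lambda>t. if t \<in> A N then g t else 0) = integral (A N) g" for N
    using restr by (rule integral_unique)
  ultimately show ?thesis
    using integral_unique[OF gi] by (simp add: A_def g_def[abs_def])
qed

text \<open>
  Unfolding: the shift by \<open>k P\<close> corresponds under \<open>t = e\<^sup>x\<close> to the interval from \<open>e\<^bsup>k P\<^esup>\<close> to \<open>e\<^bsup>(k + 1) P\<^esup>\<close>, and
  these intervals exhaust the range \<open>0 < t\<close> of Euler's integral.
\<close>
lemma log_period_sum_integral:
  assumes \<beta>: "0 < Re \<beta>" and P: "0 < P"
  shows "((\<lambda>x. log_period_sum \<beta> P (of_real x)) has_integral Gamma \<beta>) {0..P}"
proof -
  define g where "g t = of_real t powr (\<beta> - 1) / of_real (exp t)" for t :: real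
  define e where "e k = exp (of_int k * P)" for k :: int
  define Q where "Q k = integral {e k..e (k + 1)} g" for k
  have e_pos: "e k > 0" for k by (simp add: e_def)
  have e_mono: "e j \<le> e k" if "j \<le> k" for j k
    using that P by (simp add: e_def mult_right_mono)
  have contg: "continuous_on {a..b} g" if "a > 0" for a b
    unfolding g_def by (intro continuous_intros) (use that in auto)
  have Q: "((\<lambda>x. log_integrand \<beta> (of_real x + of_real (of_int k * P))) has_integral Q k) {0..P}" for k
  proof -
    define p where "p = of_int k * P"
    have p1: "of_int (k + 1) * P = P + p" by (simp add: p_def algebra_simps)
    have "((\<lambda>x. exp (x + p) *\<^sub>R g (exp (x + p))) has_integral
        (integral {exp (0 + p)..exp (P + p)} g)) {0..P}"
    proof (rule has_integral_substitution[where c = "exp p" and d = "exp (P + p)"])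
      show "continuous_on {exp p..exp (P + p)} g" by (rule contg) simp
    qed (use P in \<open>auto intro!: derivative_eq_intros\<close>)
    then have "((\<lambda>x. exp (x + p) *\<^sub>R g (exp (x + p))) has_integral Q k) {0..P}"
      unfolding Q_def e_def p1 by (simp add: p_def)
    also have "(\<lambda>x. exp (x + p) *\<^sub>R g (exp (x + p))) = (\<lambda>x. log_integrand \<beta> (of_real x + of_real p))"
    proof
      fix x
      define y where "y = x + p"
      have ln: "Ln (of_real (exp y)) = of_real y" by (simp add: Ln_of_real)
      have "exp y *\<^sub>R g (exp y) = exp (of_real y) * (exp ((\<beta> - 1) * of_real y) / exp (exp (of_real y)))"
        by (simp add: g_def powr_def ln scaleR_conv_of_real exp_of_real[symmetric])
      also have "\<dots> = log_integrand \<beta> (of_real y)"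
        unfolding log_integrand_def exp_add[symmetric] exp_diff[symmetric] by (simp add: algebra_simps)
      finally show "exp (x + p) *\<^sub>R g (exp (x + p)) = log_integrand \<beta> (of_real x + of_real p)"
        by (simp add: y_def)
    qed
    finally show ?thesis by (simp add: p_def)
  qed
  have Qsum: "(\<Sum>k\<in>{- int N..<int N}. Q k) = integral {e (- int N)..e (int N)} g" for N
  proof (induction N)
    case 0
    then show ?case by simp
  next
    case (Suc N)
    have int: "g integrable_on {e j..e k}" for j k
      by (intro integrable_continuous_real contg e_pos)
    have "{- int (Suc N)..<int (Suc N)} = insert (- int N - 1) (insert (int N) {- int N..<int N})" by auto
    then have "(\<Sum>k\<in>{- int (Suc N)..<int (Suc N)}. Q k) = Q (- int N - 1) + (Q (int N) + integral {e (- int N)..e (int N)} g)"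
      by (simp add: Suc)
    also have "Q (int N) + integral {e (- int N)..e (int N)} g = integral {e (- int N)..e (int N + 1)} g"
      unfolding Q_def by (subst add.commute, rule Henstock_Kurzweil_Integration.integral_combine) (auto intro!: e_mono int)
    also have "Q (- int N - 1) + \<dots> = integral {e (- int N - 1)..e (int N + 1)} g"
      unfolding Q_def diff_add_cancel
      by (rule Henstock_Kurzweil_Integration.integral_combine) (auto intro!: e_mono int)
    also have "- int N - 1 = - int (Suc N)" by simp
    also have "int N + 1 = int (Suc N)" by simp
    finally show ?case .
  qed
  have ul: "uniform_limit (cbox 0 P) (\<lambda>X x. \<Sum>k\<in>X. log_integrand \<beta> (of_real x + of_real (of_int k * P)))
              (\<lambda>x. log_period_sum \<beta> P (of_real x)) (finite_subsets_at_top UNIV)"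
  proof -
    have "uniform_limit (of_real ` {0..P}) (\<lambda>X y. \<Sum>k\<in>X. log_integrand \<beta> (y + of_real (of_int k * P))) (log_period_sum \<beta> P) (finite_subsets_at_top UNIV)"
      by (rule log_period_sum_uniform_limit[OF \<beta> P, of 0 _ P]) auto
    then show ?thesis by (rule uniform_limit_compose') auto
  qed
  obtain I J where I: "\<And>X. ((\<lambda>x. \<Sum>k\<in>X. log_integrand \<beta> (of_real x + of_real (of_int k * P))) has_integral I X) (cbox 0 P)"
    and J: "((\<lambda>x. log_period_sum \<beta> P (of_real x)) has_integral J) (cbox 0 P)"
    and IJ: "(I \<longlongrightarrow> J) (finite_subsets_at_top UNIV)"
    by (rule uniform_limit_integral_cbox[OF ul]) (auto simp: log_integrand_def intro!: continuous_intros)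
  have I_eq: "I X = (\<Sum>k\<in>X. Q k)" if "finite X" for X
    using has_integral_unique[OF I[of X] has_integral_sum[OF that, of _ _ "cbox 0 P"]] Q by simp
  have "filterlim (\<lambda>N. {- int N..<int N}) (finite_subsets_at_top UNIV) sequentially"
    unfolding filterlim_finite_subsets_at_top
  proof (intro allI impI)
    fix X :: "int set" assume X: "finite X \<and> X \<subseteq> UNIV"
    then obtain B where B: "\<And>k. k \<in> X \<Longrightarrow> \<bar>k\<bar> \<le> B"
      by (metis abs_le_iff bounded_iff finite_imp_bounded finite_abs_int_segment Max_ge finite_imageI imageI)
    show "\<forall>\<^sub>F N in sequentially. finite {- int N..<int N} \<and> X \<subseteq> {- int N..<int N} \<and> {- int N..<int N} \<subseteq> UNIV"
      using B by (intro eventually_sequentiallyI[of "nat B + 1"]) force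
  qed
  then have "(\<lambda>N. I {- int N..<int N}) \<longlonglongrightarrow> J" by (rule filterlim_compose[OF IJ])
  then have "(\<lambda>N. integral {exp (- (real N * P))..exp (real N * P)} g) \<longlonglongrightarrow> J"
    by (simp add: I_eq Qsum e_def)
  then have "J = Gamma \<beta>"
    using Gamma_integral_on_geometric_intervals[OF \<beta> P] LIMSEQ_unique by (auto simp: g_def[abs_def])
  then show ?thesis using J by simp
qed

text \<open>
  As the character is \<open>P\<close>-periodic, it may be moved inside the periodization, where it shifts \<open>\<beta>\<close>. Hence every Fourier
  coefficient is an instance of \<open>log_period_sum_integral\<close>.
\<close>
lemma log_period_sum_times_character:
  assumes "c * P = 2 * pi"
  shows "log_period_sum \<beta> P y * exp (- (\<i> * of_real c * of_nat n * y)) = log_period_sum (\<beta> - \<i> * of_real c * of_nat n) P y"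
proof -
  have "log_integrand \<beta> (y + of_real (of_int k * P)) * exp (- (\<i> * of_real c * of_nat n * y))
         = log_integrand (\<beta> - \<i> * of_real c * of_nat n) (y + of_real (of_int k * P))" for k :: int
  proof -
    have "exp (\<i> * of_real c * of_nat n * of_real (of_int k * P)) = exp (\<i> * (of_int (int n * k) * (of_real pi * 2)))"
    proof -
      have "complex_of_real c * of_real P = 2 * of_real pi"
        using assms by (metis of_real_mult of_real_numeral)
      then have "\<i> * of_real c * of_nat n * of_real (of_int k * P) = \<i> * (of_int (int n * k) * (of_real pi * 2))"
        by (simp add: algebra_simps)
      then show ?thesis by (simp only:)
    qed
    also have "\<dots> = 1" by (rule exp_2pi_1_int)
    finally have per: "exp (\<i> * of_real c * of_nat n * of_real (of_int k * P)) = 1" .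
    have "log_integrand (\<beta> - \<i> * of_real c * of_nat n) (y + of_real (of_int k * P)) * exp (\<i> * of_real c * of_nat n * of_real (of_int k * P)) =
      log_integrand \<beta> (y + of_real (of_int k * P)) * exp (- (\<i> * of_real c * of_nat n * y))"
      unfolding log_integrand_def exp_add[symmetric] by (simp add: algebra_simps)
    then show ?thesis unfolding per by simp
  qed
  then show ?thesis
    unfolding log_period_sum_def by (subst infsum_cmult_left'[symmetric]) simp
qed

text \<open>
  The periodic function in the variable \<open>w = exp (i c y)\<close>. The value does not depend on the branch of the logarithm
  because two branches differ by a multiple of the period; the principal one is a mere choice.
\<close>
definition annulus_fun :: "complex \<Rightarrow> real \<Rightarrow> complex \<Rightarrow> complex" where
  "annulus_fun \<beta> c w = log_period_sum \<beta> (2 * pi / c) (Ln w / (\<i> * of_real c))"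

lemma annulus_fun_exp:
  assumes "0 < c"
  shows "annulus_fun \<beta> c (exp (\<i> * of_real c * y)) = log_period_sum \<beta> (2 * pi / c) y"
proof -
  have "exp (Ln (exp (\<i> * of_real c * y))) = exp (\<i> * of_real c * y)" by simp
  then obtain n :: int where "Ln (exp (\<i> * of_real c * y)) = \<i> * of_real c * y + of_real (of_int (2 * n) * pi) * \<i>"
    unfolding exp_eq by blast
  then have "Ln (exp (\<i> * of_real c * y)) / (\<i> * of_real c) = y + of_real (of_int n * (2 * pi / c))"
    using assms by (simp add: field_simps)
  then show ?thesis unfolding annulus_fun_def by (simp only: log_period_sum_periodic)
qed

lemma annulus_fun_holomorphic:
  assumes \<beta>: "0 < Re \<beta>" and c: "0 < c"
  shows "annulus_fun \<beta> c holomorphic_on {w. exp (- (c * pi / 2)) < norm w \<and> norm w < exp (c * pi / 2)}" (is "_ holomorphic_on ?A")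
proof -
  let ?S = "{y. \<bar>Im y\<bar> < pi / 2}"
  have opA: "open ?A"
    by (intro open_Collect_conj open_Collect_less continuous_intros)
  have opS: "open ?S" by (intro open_Collect_less continuous_intros)
  have gS: "log_period_sum \<beta> (2 * pi / c) holomorphic_on ?S" using assms by (intro log_period_sum_holomorphic) auto
  \<comment> \<open>\<open>Ln\<close> is not continuous on the negative reals, but by periodicity any local branch \<open>L\<close> may replace it\<close>
  have branch: "annulus_fun \<beta> c field_differentiable at w"
    if w: "w \<in> ?A" and U: "open U" "w \<in> U" "L holomorphic_on U" "\<And>z. z \<in> U \<Longrightarrow> exp (L z) = z" for w U L
  proof -
    have L: "exp (\<i> * of_real c * (L z / (\<i> * of_real c))) = z" if "z \<in> U" for z
      using that U c by simp
    have im: "L z / (\<i> * of_real c) \<in> ?S" if z: "z \<in> U \<inter> ?A" for z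
    proof -
      have "norm z = exp (Re (L z))" using U z by (metis IntD1 norm_exp_eq_Re)
      then have "\<bar>Re (L z)\<bar> < c * pi / 2" using z by auto
      moreover have eq: "Im (L z / (\<i> * of_real c)) = - Re (L z) / c"
        using c by (simp add: Im_divide power2_eq_square field_simps)
      ultimately show ?thesis
        using c unfolding mem_Collect_eq eq by (simp add: abs_divide field_simps)
    qed
    have "(log_period_sum \<beta> (2 * pi / c) \<circ> (\<lambda>z. L z / (\<i> * of_real c))) holomorphic_on (U \<inter> ?A)"
      by (rule holomorphic_on_compose_gen[OF _ gS])
         (use im c in \<open>auto intro!: holomorphic_intros holomorphic_on_subset[OF U(3)]\<close>)
    moreover have "annulus_fun \<beta> c z = (log_period_sum \<beta> (2 * pi / c) \<circ> (\<lambda>z. L z / (\<i> * of_real c))) z" if "z \<in> U \<inter> ?A" for z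
      using annulus_fun_exp[OF c, of \<beta> "L z / (\<i> * of_real c)"] L that by simp
    ultimately have "annulus_fun \<beta> c holomorphic_on (U \<inter> ?A)"
      using holomorphic_transform by (metis (no_types, lifting))
    then show ?thesis
      using w U opA by (meson IntI holomorphic_on_imp_differentiable_at open_Int)
  qed
  have "annulus_fun \<beta> c field_differentiable at w" if w: "w \<in> ?A" for w
  proof (cases "w \<in> \<real>\<^sub>\<le>\<^sub>0")
    case False
    have "exp (Ln z) = z" if "z \<in> - \<real>\<^sub>\<le>\<^sub>0" for z :: complex
      using that by (metis ComplD exp_Ln nonpos_Reals_zero_I)
    then show ?thesis
      by (intro branch[OF w, of "- \<real>\<^sub>\<le>\<^sub>0" Ln]) (use False in \<open>auto intro!: holomorphic_intros simp: open_Compl\<close>)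
  next
    case True
    have w0: "w \<noteq> 0" using w by auto
    show ?thesis
    proof (rule branch[OF w, of "{z. Re z < 0}" "\<lambda>z. Ln (- z) + \<i> * of_real pi"])
      show "open {z. Re z < 0}" by (rule open_halfspace_Re_lt)
      show "w \<in> {z. Re z < 0}" using True w0 by (auto simp: complex_nonpos_Reals_iff complex_eq_iff)
      show "(\<lambda>z. Ln (- z) + \<i> * of_real pi) holomorphic_on {z. Re z < 0}"
        by (intro holomorphic_intros) (auto simp: complex_nonpos_Reals_iff)
      show "exp (Ln (- z) + \<i> * of_real pi) = z" if "z \<in> {z. Re z < 0}" for z
      proof -
        have "z \<noteq> 0" using that by auto
        then show ?thesis by (simp add: exp_add)
      qed
    qed
  qed
  then show ?thesis unfolding holomorphic_on_def using field_differentiable_at_within by blast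
qed

lemma annulus_fun_coeff:
  assumes \<beta>: "0 < Re \<beta>" and c: "0 < c"
  shows "contour_integral (circlepath 0 1) (\<lambda>\<zeta>. annulus_fun \<beta> c \<zeta> / \<zeta> ^ Suc n) / (2 * of_real pi * \<i>)
           = of_real (c / (2 * pi)) * Gamma (\<beta> - \<i> * of_real c * of_nat n)"
proof -
  define P where "P = 2 * pi / c"
  have P: "P > 0" "c * P = 2 * pi" using c by (auto simp: P_def)
  have "((\<lambda>x. log_period_sum (\<beta> - \<i> * of_real c * of_nat n) P (of_real x)) has_integral Gamma (\<beta> - \<i> * of_real c * of_nat n)) {0..P}"
    using \<beta> P by (intro log_period_sum_integral) auto
  then have "((\<lambda>x. log_period_sum (\<beta> - \<i> * of_real c * of_nat n) P (of_real ((1 / c) * x + 0))) has_integral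
        (1 / \<bar>1 / c\<bar> ^ DIM(real)) *\<^sub>R Gamma (\<beta> - \<i> * of_real c * of_nat n)) ((\<lambda>x. (1 / (1 / c)) *\<^sub>R x + - ((1 / (1 / c)) *\<^sub>R 0)) ` cbox 0 P)"
    using has_integral_affinity[of "\<lambda>x. log_period_sum (\<beta> - \<i> * of_real c * of_nat n) P (of_real x)" _ 0 P "1 / c" 0] c by simp
  moreover have "(\<lambda>x. (1 / (1 / c)) *\<^sub>R x + - ((1 / (1 / c)) *\<^sub>R 0)) ` cbox 0 P = {0..2 * pi}"
    using P c by (simp add: image_mult_atLeastAtMost)
  ultimately have int: "((\<lambda>t. log_period_sum (\<beta> - \<i> * of_real c * of_nat n) P (of_real (t / c))) has_integral
        (of_real c * Gamma (\<beta> - \<i> * of_real c * of_nat n))) {0..2 * pi}"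
    using c by (simp add: scaleR_conv_of_real)
  have integrand: "annulus_fun \<beta> c (cis t) / cis t ^ Suc n * (\<i> * cis t) = \<i> * log_period_sum (\<beta> - \<i> * of_real c * of_nat n) P (of_real (t / c))" for t
  proof -
    have e: "\<i> * of_real c * of_real (t / c) = \<i> * of_real t" using c by simp
    have cis_eq: "cis t = exp (\<i> * of_real c * of_real (t / c))" unfolding e by (simp add: cis_conv_exp)
    have g: "annulus_fun \<beta> c (cis t) = log_period_sum \<beta> P (of_real (t / c))"
      unfolding cis_eq P_def by (rule annulus_fun_exp[OF c])
    have "inverse (cis t ^ n) = exp (- (\<i> * of_real c * of_nat n * of_real (t / c)))"
      using c by (simp add: cis_conv_exp exp_minus exp_of_nat_mult[symmetric] mult_ac)
    then have "annulus_fun \<beta> c (cis t) * inverse (cis t ^ n) = log_period_sum (\<beta> - \<i> * of_real c * of_nat n) P (of_real (t / c))"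
      unfolding g using log_period_sum_times_character[OF P(2), of \<beta> "of_real (t / c)" n] by simp
    moreover have "annulus_fun \<beta> c (cis t) / cis t ^ Suc n * (\<i> * cis t) = \<i> * (annulus_fun \<beta> c (cis t) * inverse (cis t ^ n))"
      by (simp add: field_simps)
    ultimately show ?thesis by (simp only:)
  qed
  have "contour_integral (circlepath 0 1) (\<lambda>\<zeta>. annulus_fun \<beta> c \<zeta> / \<zeta> ^ Suc n)
     = integral {0..2 * pi} (\<lambda>t. annulus_fun \<beta> c (cis t) / cis t ^ Suc n * (\<i> * cis t))"
    unfolding circlepath_def by (subst contour_integral_part_circlepath_eq) (auto simp: mult_ac)
  also have "\<dots> = \<i> * (of_real c * Gamma (\<beta> - \<i> * of_real c * of_nat n))"
    unfolding integrand by (rule integral_unique[OF has_integral_mult_right[OF int]])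
  finally show ?thesis by (simp add: field_simps)
qed

section \<open>Operations on power series with a natural boundary\<close>

text \<open>
  Analytic continuation of the sum of a power series across one point \<open>z0\<close> of the circle of radius \<open>R\<close>.
\<close>
definition powser_continues :: "(nat \<Rightarrow> complex) \<Rightarrow> real \<Rightarrow> complex \<Rightarrow> bool" where
  "powser_continues a R z0 \<longleftrightarrow>
     (\<exists>r>0. \<exists>g. g holomorphic_on ball z0 r \<and>
        (\<forall>z \<in> ball z0 r \<inter> ball 0 R. g z = (\<Sum>n. a n * z ^ n)))"

lemma powser_holomorphic:
  fixes a :: "nat \<Rightarrow> complex"
  assumes "\<And>z. norm z < K \<Longrightarrow> summable (\<lambda>n. a n * z ^ n)"
  shows "(\<lambda>z. \<Sum>n. a n * z ^ n) holomorphic_on ball 0 K"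
  unfolding holomorphic_on_def field_differentiable_def
  using termdiffs_strong'[of K a, OF assms]
  by (metis has_field_derivative_at_within mem_ball_0)

text \<open>
  Convergence in the disc of radius \<open>R\<close> is enough: a larger radius of convergence would itself continue the sum across
  every point of the circle. So no lower bound for the coefficients is ever required.
\<close>
lemma has_natural_boundary_iff:
  "has_natural_boundary a R \<longleftrightarrow>
     0 < R \<and> (\<forall>z. norm z < R \<longrightarrow> summable (\<lambda>n. a n * z ^ n)) \<and>
     (\<forall>z0. norm z0 = R \<longrightarrow> \<not> powser_continues a R z0)" (is "_ \<longleftrightarrow> ?rhs")
proof
  assume "has_natural_boundary a R"
  then show ?rhs
    unfolding has_natural_boundary_def powser_continues_def
    by (auto intro!: summable_in_conv_radius)
next
  assume R: ?rhs
  have "conv_radius a \<ge> ereal R"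
  proof (rule conv_radius_geI_ex')
    fix r assume "0 < r" "ereal r < ereal R"
    then show "summable (\<lambda>n. a n * of_real r ^ n)" using R by simp
  qed
  moreover have "\<not> conv_radius a > ereal R"
  proof
    assume "conv_radius a > ereal R"
    then obtain K where K: "R < K" "ereal K < conv_radius a"
      using ereal_dense2 by (metis ereal_less_eq(3) less_ereal.simps(1))
    have "(\<lambda>z. \<Sum>n. a n * z ^ n) holomorphic_on ball 0 K"
    proof (rule powser_holomorphic)
      fix z :: complex assume "norm z < K"
      then have "ereal (norm z) < conv_radius a" using K by (meson less_ereal.simps(1) order.strict_trans)
      then show "summable (\<lambda>n. a n * z ^ n)" by (rule summable_in_conv_radius)
    qed
    moreover have "ball (of_real R) (K - R) \<subseteq> ball (0::complex) K"
      using R by (intro ball_subset_ball_iff[THEN iffD2]) (auto simp: dist_norm)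
    ultimately have "powser_continues a R (of_real R)"
      unfolding powser_continues_def using K
      by (intro exI[of _ "K - R"] conjI exI[of _ "\<lambda>z. \<Sum>n. a n * z ^ n"])
         (auto intro: holomorphic_on_subset)
    then show False using R by simp
  qed
  ultimately have "conv_radius a = ereal R" by (simp add: order.antisym not_less)
  then show "has_natural_boundary a R"
    using R unfolding has_natural_boundary_def powser_continues_def by blast
qed

lemma has_natural_boundary_cnj:
  assumes "has_natural_boundary a R"
  shows "has_natural_boundary (\<lambda>n. cnj (a n)) R"
  unfolding has_natural_boundary_iff
proof (intro conjI allI impI)
  note nb = assms[unfolded has_natural_boundary_iff]
  show "0 < R" using nb by blast
  have sums: "(\<lambda>n. cnj (a n) * z ^ n) sums cnj (\<Sum>n. a n * cnj z ^ n)" if "norm z < R" for z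
  proof -
    have "(\<lambda>n. a n * cnj z ^ n) sums (\<Sum>n. a n * cnj z ^ n)"
      using nb that by (intro summable_sums) auto
    then have "(\<lambda>n. cnj (a n * cnj z ^ n)) sums cnj (\<Sum>n. a n * cnj z ^ n)" by (simp only: sums_cnj)
    then show ?thesis by simp
  qed
  then show "summable (\<lambda>n. cnj (a n) * z ^ n)" if "norm z < R" for z
    using that sums_summable by blast
  fix z0 :: complex assume z0: "norm z0 = R"
  show "\<not> powser_continues (\<lambda>n. cnj (a n)) R z0"
  proof
    assume "powser_continues (\<lambda>n. cnj (a n)) R z0"
    then obtain r g where rg: "r > 0" "g holomorphic_on ball z0 r"
      "\<And>z. z \<in> ball z0 r \<Longrightarrow> norm z < R \<Longrightarrow> g z = (\<Sum>n. cnj (a n) * z ^ n)"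
      unfolding powser_continues_def by auto
    have ball: "cnj ` ball (cnj z0) r = ball z0 r"
    proof -
      have d: "dist z0 (cnj z) = dist (cnj z0) z" for z
        by (metis complex_cnj_cnj complex_cnj_diff complex_mod_cnj dist_norm)
      show ?thesis
      proof (intro equalityI subsetI)
        fix x assume "x \<in> ball z0 r"
        then show "x \<in> cnj ` ball (cnj z0) r"
          using d[of "cnj x"] by (intro image_eqI[of _ _ "cnj x"]) auto
      qed (auto simp: d)
    qed
    have "cnj \<circ> g \<circ> cnj holomorphic_on ball (cnj z0) r"
      by (rule holomorphic_on_compose_cnj_cnj) (use rg ball in auto)
    moreover have "(cnj \<circ> g \<circ> cnj) z = (\<Sum>n. a n * z ^ n)" if "z \<in> ball (cnj z0) r" "norm z < R" for z
    proof -
      have "g (cnj z) = (\<Sum>n. cnj (a n) * cnj z ^ n)" 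
      proof (rule rg(3))
        show "cnj z \<in> ball z0 r" using that(1) ball by blast
      qed (use that in simp)
      also have "\<dots> = cnj (\<Sum>n. a n * z ^ n)"
        using sums[of "cnj z"] that by (simp add: sums_iff)
      finally show ?thesis by simp
    qed
    ultimately have "powser_continues a R (cnj z0)"
      unfolding powser_continues_def using rg(1) by (auto intro!: exI[of _ r] exI[of _ "cnj \<circ> g \<circ> cnj"])
    then show False using nb z0 by simp
  qed
qed

text \<open>
  The series with coefficients \<open>(\<alpha> + \<gamma> n) a\<^sub>n\<close> is \<open>\<alpha> f + \<gamma> z f'\<close>, where \<open>f\<close> is the sum of \<open>a\<^sub>n z\<^sup>n\<close>. If \<open>g\<close> continues \<open>f\<close>,
  then \<open>\<alpha> g + \<gamma> z g'\<close> continues that series.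
\<close>
lemma has_natural_boundary_Euler_operator:
  assumes nb: "has_natural_boundary (\<lambda>n. (\<alpha> + \<gamma> * of_nat n) * a n) R" and \<gamma>: "\<gamma> \<noteq> 0"
  shows "has_natural_boundary a R"
  unfolding has_natural_boundary_iff
proof (intro conjI allI impI)
  note nb = nb[unfolded has_natural_boundary_iff]
  show "0 < R" using nb by blast
  have R: "\<forall>z. norm z < R \<longrightarrow> summable (\<lambda>n. norm (((\<alpha> + \<gamma> * of_nat n) * a n) * z ^ n))"
  proof (intro allI impI)
    fix z :: complex assume "norm z < R"
    \<comment> \<open>convergence at a slightly larger radius gives absolute convergence at \<open>z\<close>\<close>
    then obtain K where K: "norm z < K" "K < R" using dense by blast
    have "summable (\<lambda>n. ((\<alpha> + \<gamma> * of_nat n) * a n) * of_real K ^ n)"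
    proof -
      have "norm (of_real K :: complex) < R" using K norm_ge_zero[of z] by (simp del: norm_ge_zero)
      then show ?thesis using nb by blast
    qed
    then show "summable (\<lambda>n. norm (((\<alpha> + \<gamma> * of_nat n) * a n) * z ^ n))"
      by (rule powser_insidea) (use K in auto)
  qed
  show sm: "summable (\<lambda>n. a n * z ^ n)" if z: "norm z < R" for z
  proof (rule summable_comparison_test_ev)
    have "filterlim (\<lambda>n. norm \<gamma> * real n) at_top sequentially"
      using \<gamma> by (intro filterlim_tendsto_pos_mult_at_top[OF tendsto_const] filterlim_real_sequentially) auto
    then have "\<forall>\<^sub>F n in sequentially. norm \<alpha> + 1 \<le> norm \<gamma> * real n" by (simp add: filterlim_at_top)
    then show "\<forall>\<^sub>F n in sequentially. norm (a n * z ^ n) \<le> norm (((\<alpha> + \<gamma> * of_nat n) * a n) * z ^ n)"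
    proof (rule eventually_mono)
      fix n assume "norm \<alpha> + 1 \<le> norm \<gamma> * real n"
      then have "1 \<le> norm (\<alpha> + \<gamma> * of_nat n)"
        using norm_diff_ineq[of "\<gamma> * of_nat n" \<alpha>] by (simp add: norm_mult add.commute)
      then have "1 * norm (a n * z ^ n) \<le> norm (\<alpha> + \<gamma> * of_nat n) * norm (a n * z ^ n)"
        by (intro mult_right_mono) auto
      then show "norm (a n * z ^ n) \<le> norm (((\<alpha> + \<gamma> * of_nat n) * a n) * z ^ n)"
        by (simp add: norm_mult mult.assoc)
    qed
    show "summable (\<lambda>n. norm (((\<alpha> + \<gamma> * of_nat n) * a n) * z ^ n))" using R z by blast
  qed
  fix z0 :: complex assume z0: "norm z0 = R"
  show "\<not> powser_continues a R z0"
  proof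
    assume "powser_continues a R z0"
    then obtain r g where rg: "r > 0" "g holomorphic_on ball z0 r"
      "\<And>z. z \<in> ball z0 r \<Longrightarrow> norm z < R \<Longrightarrow> g z = (\<Sum>n. a n * z ^ n)"
      unfolding powser_continues_def by auto
    have "(\<lambda>z. \<alpha> * g z + \<gamma> * z * deriv g z) holomorphic_on ball z0 r"
      by (intro holomorphic_intros rg) auto
    moreover have "\<alpha> * g z + \<gamma> * z * deriv g z = (\<Sum>n. ((\<alpha> + \<gamma> * of_nat n) * a n) * z ^ n)"
      if z: "z \<in> ball z0 r" "norm z < R" for z
    proof -
      have der: "((\<lambda>z. \<Sum>n. a n * z^n) has_field_derivative (\<Sum>n. diffs a n * z^n)) (at z)"
        by (rule termdiffs_strong'[OF sm]) (use z in auto)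
      have "(g has_field_derivative (\<Sum>n. diffs a n * z^n)) (at z)"
      proof (rule has_field_derivative_transform_within_open[OF der])
        show "open (ball z0 r \<inter> ball 0 R)" by auto
      qed (use z rg(3) in auto)
      then have dg: "deriv g z = (\<Sum>n. diffs a n * z^n)" by (rule DERIV_imp_deriv)
      have "(\<lambda>n. of_nat n * a n * z ^ (n - Suc 0)) sums deriv g z"
        unfolding dg by (intro diffs_equiv termdiff_converges[of z R] sm) (use z in auto)
      then have "(\<lambda>n. \<alpha> * (a n * z ^ n) + \<gamma> * z * (of_nat n * a n * z ^ (n - Suc 0))) sums (\<alpha> * g z + \<gamma> * z * deriv g z)"
        unfolding rg(3)[OF z] by (intro sums_add sums_mult summable_sums sm z)
      moreover have "\<alpha> * (a n * z ^ n) + \<gamma> * z * (of_nat n * a n * z ^ (n - Suc 0)) = ((\<alpha> + \<gamma> * of_nat n) * a n) * z ^ n" for n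
        by (cases n) (auto simp: algebra_simps)
      ultimately show ?thesis by (simp add: sums_iff)
    qed
    ultimately have "powser_continues (\<lambda>n. (\<alpha> + \<gamma> * of_nat n) * a n) R z0"
      unfolding powser_continues_def using rg(1)
      by (intro exI[of _ r] conjI exI[of _ "\<lambda>z. \<alpha> * g z + \<gamma> * z * deriv g z"]) auto
    then show False using nb z0 by blast
  qed
qed

section \<open>Series with coefficients on a vertical line\<close>

text \<open>
  A continuation \<open>g\<close> at \<open>w0\<close> together with the other Laurent part \<open>h\<close> extends the function on the annulus
  continuously to \<open>w0\<close>. So it would be bounded near \<open>w0\<close>, and the periodic function would be bounded near the point
  \<open>y0\<close> with \<open>exp (i c y0) = w0\<close>, which has \<open>Im y0 = - \<pi> / 2\<close>.
\<close>
lemma Gamma_line_series: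
  assumes \<beta>: "0 < Re \<beta>" and c: "0 < c"
  shows "has_natural_boundary (\<lambda>n. Gamma (\<beta> - \<i> * of_real c * of_nat n)) (exp (c * pi / 2))"
  unfolding has_natural_boundary_iff
proof (intro conjI allI impI)
  define R where "R = exp (c * pi / 2)"
  define G where "G n = Gamma (\<beta> - \<i> * of_real c * of_nat n)" for n
  define k :: complex where "k = of_real (c / (2 * pi))"
  have k: "k \<noteq> 0" using c by (simp add: k_def)
  have R1: "1 < R" using c by (simp add: R_def)
  show "0 < exp (c * pi / 2)" by simp
  obtain h where h: "h holomorphic_on {z. 1 < norm z}"
    and sm: "\<And>w. norm w < R \<Longrightarrow> summable (\<lambda>n. k * G n * w ^ n)"
    and dec: "\<And>w. 1 < norm w \<Longrightarrow> norm w < R \<Longrightarrow> annulus_fun \<beta> c w = (\<Sum>n. k * G n * w ^ n) + h w"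
  proof (rule Laurent_nonneg_part[OF annulus_fun_holomorphic[OF \<beta> c], of 1, unfolded annulus_fun_coeff[OF \<beta> c]])
    fix h assume "h holomorphic_on {z. 1 < norm z}"
      "\<And>w. norm w < exp (c * pi / 2) \<Longrightarrow>
             summable (\<lambda>n. of_real (c / (2 * pi)) * Gamma (\<beta> - \<i> * of_real c * of_nat n) * w ^ n)"
      "\<And>w. 1 < norm w \<Longrightarrow> norm w < exp (c * pi / 2) \<Longrightarrow>
             annulus_fun \<beta> c w = (\<Sum>n. of_real (c / (2 * pi)) * Gamma (\<beta> - \<i> * of_real c * of_nat n) * w ^ n) + h w"
    then show thesis by (intro that[of h]) (simp_all only: G_def k_def R_def)
  qed (use c in auto)
  have smG: "summable (\<lambda>n. G n * w ^ n)" if "norm w < R" for w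
    using summable_mult[OF sm[OF that], of "inverse k"] k by (simp add: field_simps)
  then show "summable (\<lambda>n. Gamma (\<beta> - \<i> * of_real c * of_nat n) * w ^ n)" if "norm w < exp (c * pi / 2)" for w
    using that by (simp only: G_def R_def)
  fix w0 :: complex assume "norm w0 = exp (c * pi / 2)"
  then have w0: "norm w0 = R" by (simp add: R_def)
  show "\<not> powser_continues (\<lambda>n. Gamma (\<beta> - \<i> * of_real c * of_nat n)) (exp (c * pi / 2)) w0"
  proof
    assume "powser_continues (\<lambda>n. Gamma (\<beta> - \<i> * of_real c * of_nat n)) (exp (c * pi / 2)) w0"
    then obtain r g where rg: "r > 0" "g holomorphic_on ball w0 r"
      "\<And>w. w \<in> ball w0 r \<Longrightarrow> norm w < R \<Longrightarrow> g w = (\<Sum>n. G n * w ^ n)"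
      unfolding powser_continues_def G_def R_def by auto
    define P where "P = 2 * pi / c"
    have P: "P > 0" using c by (simp add: P_def)
    define y0 where "y0 = Ln w0 / (\<i> * of_real c)"
    have w00: "w0 \<noteq> 0" using w0 R1 by auto
    have ey0: "exp (\<i> * of_real c * y0) = w0" using c w00 by (simp add: y0_def)
    have Imy0: "Im y0 = - pi / 2"
    proof -
      have "norm (exp (\<i> * of_real c * y0)) = exp (c * pi / 2)" unfolding ey0 using w0 by (simp add: R_def)
      then have "c * Im y0 = c * (- pi / 2)" by simp
      then show ?thesis using c by (simp only: mult_cancel_left) simp
    qed
    define U where "U = ball w0 r \<inter> {w. 1 < norm w}"
    have opU: "open U" unfolding U_def by (intro open_Int open_ball open_Collect_less continuous_intros)
    have w0U: "w0 \<in> U" using rg w0 R1 by (auto simp: U_def)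
    define \<phi> where "\<phi> y = k * g (exp (\<i> * of_real c * y)) + h (exp (\<i> * of_real c * y))" for y
    have "(\<lambda>w. k * g w + h w) holomorphic_on U"
      by (intro holomorphic_intros holomorphic_on_subset[OF rg(2)] holomorphic_on_subset[OF h]) (auto simp: U_def)
    then have "isCont (\<lambda>w. k * g w + h w) w0"
      using opU w0U by (meson continuous_on_eq_continuous_at holomorphic_on_imp_continuous_on)
    moreover have cexp: "isCont (\<lambda>y. exp (\<i> * of_real c * y)) y0" by (intro continuous_intros)
    ultimately have "isCont \<phi> y0"
      unfolding \<phi>_def using isCont_o2[of y0 "\<lambda>y. exp (\<i> * of_real c * y)" "\<lambda>w. k * g w + h w"] ey0 by simp
    then have "\<forall>\<^sub>F y in nhds y0. dist (\<phi> y) (\<phi> y0) < 1"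
      unfolding continuous_at_eps_delta eventually_nhds_metric by (meson zero_less_one)
    moreover have "\<forall>\<^sub>F y in nhds y0. exp (\<i> * of_real c * y) \<in> U"
    proof -
      have "open ((\<lambda>y. exp (\<i> * of_real c * y)) -` U)"
        by (intro open_vimage opU continuous_intros)
      then show ?thesis
        unfolding eventually_nhds using ey0 w0U
        by (intro exI[of _ "(\<lambda>y. exp (\<i> * of_real c * y)) -` U"]) auto
    qed
    ultimately have "\<forall>\<^sub>F y in nhds y0. dist (\<phi> y) (\<phi> y0) < 1 \<and> exp (\<i> * of_real c * y) \<in> U"
      by (rule eventually_conj)
    then obtain e where e: "e > 0"
      "\<And>y. dist y y0 < e \<Longrightarrow> dist (\<phi> y) (\<phi> y0) < 1 \<and> exp (\<i> * of_real c * y) \<in> U"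
      unfolding eventually_nhds_metric by blast
    obtain y where y: "y \<in> ball y0 e" "\<bar>Im y\<bar> < pi / 2" "norm (\<phi> y0) + 1 < norm (log_period_sum \<beta> P y)"
      using log_period_sum_unbounded[OF \<beta> P Imy0 e(1)] by metis
    define w where "w = exp (\<i> * of_real c * y)"
    have "norm w = exp (c * (- Im y))" by (simp add: w_def)
    also have "\<dots> < R"
    proof -
      have "c * (- Im y) < c * (pi / 2)" using y(2) c by (intro mult_strict_left_mono) auto
      then show ?thesis by (simp add: R_def)
    qed
    finally have wR: "norm w < R" .
    have wU: "w \<in> U" and \<phi>y: "dist (\<phi> y) (\<phi> y0) < 1" using e(2)[of y] y(1) by (auto simp: w_def dist_commute)
    have "log_period_sum \<beta> P y = annulus_fun \<beta> c w" unfolding w_def P_def by (rule annulus_fun_exp[OF c, symmetric])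
    also have "\<dots> = (\<Sum>n. k * G n * w ^ n) + h w" using wU wR by (intro dec) (auto simp: U_def)
    also have "(\<Sum>n. k * G n * w ^ n) = k * g w"
      using rg(3)[of w] wU wR smG[OF wR] by (simp add: U_def mult.assoc suminf_mult)
    also have "k * g w + h w = \<phi> y" by (simp add: \<phi>_def w_def)
    finally have "norm (log_period_sum \<beta> P y) \<le> norm (\<phi> y0) + 1"
      using \<phi>y norm_triangle_ineq2[of "\<phi> y" "\<phi> y0"] by (simp add: dist_norm)
    then show False using y(3) by simp
  qed
qed

text \<open>
  With \<open>q = e\<^bsup>2 v\<^esup>\<close> and \<open>\<Psi>(w) = \<Sum>n. \<Gamma>(1 - u - i c n) w\<^sup>n\<close>, the reflection formula gives
  \<open>f z = A \<Psi>(z / q) - B \<Psi>(q z)\<close>. The first term is holomorphic for \<open>|z| < e\<^bsup>3 v\<^esup>\<close>, hence across \<open>|z| = e\<^sup>-\<^sup>v\<close>, and a continuation of \<open>f\<close>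
  at \<open>z0\<close> yields one of \<open>\<Psi>\<close> at \<open>q z0\<close>, a point of the circle \<open>|w| = e\<^sup>v\<close>.
\<close>
lemma rGamma_line_series_left_half:
  assumes u: "Re u < 1" and v: "0 < v"
  shows "has_natural_boundary (\<lambda>n. rGamma (u + 2 * \<i> * of_real v * of_nat n / of_real pi)) (exp (- v))"
  unfolding has_natural_boundary_iff
proof (intro conjI allI impI)
  define c where "c = 2 * v / pi"
  have c: "c > 0" "c * pi / 2 = v" using v by (auto simp: c_def)
  define G where "G n = Gamma (1 - u - \<i> * of_real c * of_nat n)" for n
  have nbG: "has_natural_boundary G (exp v)"
    using Gamma_line_series[of "1 - u" c] u c by (simp add: G_def[abs_def])
  note nbG = nbG[unfolded has_natural_boundary_iff]
  define q :: complex where "q = of_real (exp (2 * v))"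
  have q: "q \<noteq> 0" "norm q = exp (2 * v)" by (auto simp: q_def)
  define A where "A = exp (\<i> * of_real pi * u) / (2 * of_real pi * \<i>)"
  define B where "B = exp (- (\<i> * of_real pi * u)) / (2 * of_real pi * \<i>)"
  have B: "B \<noteq> 0" by (simp add: B_def)
  have coeff: "rGamma (u + 2 * \<i> * of_real v * of_nat n / of_real pi) = (A * inverse q ^ n - B * q ^ n) * G n" for n
  proof -
    define s where "s = u + 2 * \<i> * of_real v * of_nat n / of_real pi"
    have s: "1 - u - \<i> * of_real c * of_nat n = 1 - s" by (simp add: s_def c_def)
    have "Re (1 - s) > 0" using u by (simp add: s_def)
    moreover have "Re z \<le> 0" if "z \<in> \<int>\<^sub>\<le>\<^sub>0" for z :: complex
      using that by (auto elim!: nonpos_Ints_cases)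
    ultimately have "1 - s \<notin> \<int>\<^sub>\<le>\<^sub>0" by (meson not_le)
    then have "rGamma s = rGamma s * rGamma (1 - s) * Gamma (1 - s)"
      by (simp add: rGamma_inverse_Gamma Gamma_eq_zero_iff)
    also have "\<dots> = sin (of_real pi * s) / of_real pi * G n"
      unfolding rGamma_reflection_complex G_def s ..
    also have "sin (of_real pi * s) / of_real pi = (exp (\<i> * (of_real pi * s)) - exp (- (\<i> * (of_real pi * s)))) / (2 * of_real pi * \<i>)"
      by (simp add: sin_exp_eq field_simps)
    also have "\<i> * (of_real pi * s) = \<i> * of_real pi * u - of_nat n * of_real (2 * v)"
      by (simp add: s_def field_simps)
    also have "exp (\<i> * of_real pi * u - of_nat n * of_real (2 * v)) = exp (\<i> * of_real pi * u) * inverse q ^ n"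
      unfolding exp_diff exp_of_nat_mult by (simp add: q_def exp_of_real power_inverse divide_inverse del: of_real_mult)
    also have "exp (- (\<i> * of_real pi * u - of_nat n * of_real (2 * v))) = exp (- (\<i> * of_real pi * u)) * q ^ n"
      unfolding minus_diff_eq exp_diff exp_of_nat_mult
      by (simp add: q_def exp_of_real exp_minus divide_inverse mult.commute del: of_real_mult)
    finally show ?thesis by (simp add: s_def A_def B_def diff_divide_distrib)
  qed
  show "0 < exp (- v)" by simp
  have in1: "norm (inverse q * z) < exp v" if "norm z < exp (3 * v)" for z
  proof -
    have "norm (inverse q * z) = exp (- 2 * v) * norm z" using q by (simp add: norm_mult norm_inverse exp_minus)
    also have "\<dots> < exp (- 2 * v) * exp (3 * v)" using that by simp
    also have "\<dots> = exp v" by (simp add: exp_add[symmetric])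
    finally show ?thesis .
  qed
  have in2: "norm (q * z) < exp v \<longleftrightarrow> norm z < exp (- v)" for z
  proof -
    have "exp v = exp (2 * v) * exp (- v)" by (simp add: exp_add[symmetric])
    then show ?thesis using q by (simp add: norm_mult)
  qed
  have v3: "exp (- v) < exp (3 * v)" using v by simp
  have sums: "(\<lambda>n. rGamma (u + 2 * \<i> * of_real v * of_nat n / of_real pi) * z ^ n) sums
      (A * (\<Sum>n. G n * (inverse q * z) ^ n) - B * (\<Sum>n. G n * (q * z) ^ n))" if z: "norm z < exp (- v)" for z
  proof -
    have "(\<lambda>n. A * (G n * (inverse q * z) ^ n) - B * (G n * (q * z) ^ n)) sums
       (A * (\<Sum>n. G n * (inverse q * z) ^ n) - B * (\<Sum>n. G n * (q * z) ^ n))"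
      using nbG in1[of z] in2[of z] z v3 by (intro sums_diff sums_mult summable_sums) auto
    also have "(\<lambda>n. A * (G n * (inverse q * z) ^ n) - B * (G n * (q * z) ^ n)) =
       (\<lambda>n. rGamma (u + 2 * \<i> * of_real v * of_nat n / of_real pi) * z ^ n)"
      unfolding coeff power_mult_distrib by (simp add: algebra_simps)
    finally show ?thesis .
  qed
  then show "summable (\<lambda>n. rGamma (u + 2 * \<i> * of_real v * of_nat n / of_real pi) * z ^ n)"
    if "norm z < exp (- v)" for z using that sums_summable by blast
  fix z0 :: complex assume z0: "norm z0 = exp (- v)"
  show "\<not> powser_continues (\<lambda>n. rGamma (u + 2 * \<i> * of_real v * of_nat n / of_real pi)) (exp (- v)) z0"
  proof
    assume "powser_continues (\<lambda>n. rGamma (u + 2 * \<i> * of_real v * of_nat n / of_real pi)) (exp (- v)) z0"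
    then obtain r g where rg: "r > 0" "g holomorphic_on ball z0 r"
      "\<And>z. z \<in> ball z0 r \<Longrightarrow> norm z < exp (- v) \<Longrightarrow>
         g z = (\<Sum>n. rGamma (u + 2 * \<i> * of_real v * of_nat n / of_real pi) * z ^ n)"
      unfolding powser_continues_def by auto
    define \<Psi> where "\<Psi> w = (\<Sum>n. G n * w ^ n)" for w
    have \<Psi>: "\<Psi> holomorphic_on ball 0 (exp v)"
      unfolding \<Psi>_def using nbG by (intro powser_holomorphic) auto
    define w0 where "w0 = q * z0"
    have w0: "norm w0 = exp v"
      using q z0 by (simp add: w0_def norm_mult exp_add[symmetric])
    \<comment> \<open>the second bound keeps \<open>w / q\<close> inside \<open>|z| < e\<^bsup>3 v\<^esup>\<close> for \<open>w\<close> in the new disc\<close>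
    define r' where "r' = min (r * exp (2 * v)) (exp (2 * v) * exp (3 * v) - exp v)"
    have r': "r' > 0"
    proof -
      have "exp v < exp (2 * v) * exp (3 * v)" unfolding exp_add[symmetric] using v by simp
      then show ?thesis using rg by (simp add: r'_def)
    qed
    have b1: "inverse q * w \<in> ball z0 r" if "w \<in> ball w0 r'" for w
    proof -
      have "z0 - inverse q * w = inverse q * (w0 - w)" using q by (simp add: w0_def algebra_simps)
      then have "dist z0 (inverse q * w) = dist w0 w / exp (2 * v)"
        using q by (simp add: dist_norm norm_mult norm_inverse divide_inverse mult.commute)
      also have "\<dots> < r" using that by (simp add: r'_def field_simps)
      finally show ?thesis by simp
    qed
    have b2: "norm (inverse q * w) < exp (3 * v)" if "w \<in> ball w0 r'" for w
    proof -
      have "norm w \<le> norm w0 + dist w0 w" by (metis dist_norm norm_triangle_sub norm_minus_commute)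
      also have "\<dots> < exp (2 * v) * exp (3 * v)" using that w0 by (simp add: r'_def)
      finally have "norm w / exp (2 * v) < exp (3 * v)" by (simp add: pos_divide_less_eq mult.commute)
      moreover have "norm (inverse q * w) = norm w / exp (2 * v)"
        using q by (simp add: norm_mult norm_inverse divide_inverse)
      ultimately show ?thesis by simp
    qed
    define g' where "g' w = (A * \<Psi> (inverse q * (inverse q * w)) - g (inverse q * w)) / B" for w
    have "(\<Psi> \<circ> (\<lambda>w. inverse q * (inverse q * w))) holomorphic_on ball w0 r'"
      by (rule holomorphic_on_compose_gen[OF _ \<Psi>]) (use b2 in1 in \<open>auto intro!: holomorphic_intros\<close>)
    moreover have "(g \<circ> (\<lambda>w. inverse q * w)) holomorphic_on ball w0 r'"
      by (rule holomorphic_on_compose_gen[OF _ rg(2)]) (use b1 in \<open>auto intro!: holomorphic_intros\<close>)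
    ultimately have "g' holomorphic_on ball w0 r'"
      unfolding g'_def o_def by (intro holomorphic_intros) (use B in auto)
    moreover have "g' w = (\<Sum>n. G n * w ^ n)" if w: "w \<in> ball w0 r'" "norm w < exp v" for w
    proof -
      define z where "z = inverse q * w"
      have qz: "q * z = w" using q by (simp add: z_def)
      have z: "norm z < exp (- v)" using w(2) in2[of z] qz by simp
      have "g z = A * \<Psi> (inverse q * z) - B * \<Psi> (q * z)"
        using rg(3)[of z] b1[OF w(1)] z sums[OF z] unfolding z_def[symmetric] \<Psi>_def by (simp add: sums_iff)
      then show ?thesis using B unfolding g'_def z_def[symmetric] qz \<Psi>_def by (simp add: field_simps)
    qed
    ultimately have "powser_continues G (exp v) w0"
      unfolding powser_continues_def using r' by (intro exI[of _ r'] conjI exI[of _ g']) auto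
    then show False using nbG w0 by blast
  qed
qed

lemma rGamma_line_series_upward:
  assumes v: "0 < v"
  shows "has_natural_boundary (\<lambda>n. rGamma (u + 2 * \<i> * of_real v * of_nat n / of_real pi)) (exp (- v))"
proof -
  have "has_natural_boundary (\<lambda>n. rGamma (u + 2 * \<i> * of_real v * of_nat n / of_real pi)) (exp (- v))"
    if "Re u < 1 + real N" for N u
    using that
  proof (induction N arbitrary: u)
    case 0
    then show ?case by (intro rGamma_line_series_left_half v) simp
  next
    case (Suc N)
    have "has_natural_boundary (\<lambda>n. rGamma (u - 1 + 2 * \<i> * of_real v * of_nat n / of_real pi)) (exp (- v))"
      by (rule Suc.IH) (use Suc.prems in simp)
    moreover have "rGamma (u - 1 + 2 * \<i> * of_real v * of_nat n / of_real pi)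
      = ((u - 1) + (2 * \<i> * of_real v / of_real pi) * of_nat n) * rGamma (u + 2 * \<i> * of_real v * of_nat n / of_real pi)" for n
    proof -
      define x where "x = 2 * \<i> * of_real v * of_nat n / of_real pi"
      have "rGamma (u - 1 + x) = (u - 1 + x) * rGamma (u - 1 + x + 1)"
        by (rule rGamma_plus1[symmetric])
      also have "u - 1 + x + 1 = u + x" by simp
      finally show ?thesis by (simp add: x_def)
    qed
    ultimately have "has_natural_boundary (\<lambda>n. ((u - 1) + (2 * \<i> * of_real v / of_real pi) * of_nat n) *
        rGamma (u + 2 * \<i> * of_real v * of_nat n / of_real pi)) (exp (- v))" by simp
    then show ?case by (rule has_natural_boundary_Euler_operator) (use v in simp)
  qed
  moreover obtain N :: nat where "Re u < real N" using reals_Archimedean2 by blast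
  then have "Re u < 1 + real N" by simp
  ultimately show ?thesis by blast
qed

theorem mainTheorem4:
  fixes u :: complex and v :: real
  assumes "v \<noteq> 0"
  shows "has_natural_boundary
           (\<lambda>n. rGamma (u + 2 * \<i> * complex_of_real v * of_nat n / complex_of_real pi))
           (exp (- \<bar>v\<bar>))"
proof (cases "v > 0")
  case True
  then show ?thesis using rGamma_line_series_upward[of v u] by simp
next
  case False
  then have "has_natural_boundary (\<lambda>n. rGamma (cnj u + 2 * \<i> * of_real (- v) * of_nat n / of_real pi)) (exp (- (- v)))"
    using assms by (intro rGamma_line_series_upward) simp
  from has_natural_boundary_cnj[OF this] show ?thesis
    using False by (simp add: cnj_rGamma)
qed

end
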